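(* Up to combinatorial equivalence, the set of Forman--Ricci-positive $4$-dimensional polytopes is finite.
   Context: Polytopes are convex polytopes, considered up to combinatorial equivalence. For an edge $e$ of a polytope $P$, let $\mathcal{F}\uparrow(e)$ be the set of $2$-faces of $P$ containing $e$. Two distinct edges $e,e'$ are parallel neighbors if either (i) they share a vertex but are not contained in a common $2$-face, or (ii) they are vertex-disjoint but are contained in a common $2$-face. Let $\mathcal{E}(e)$ be the set of parallel neighbors of $e$. The Forman--Ricci curvature of $e$ is $\mathcal{F}(e)=|\mathcal{F}\uparrow(e)|+2-|\mathcal{E}(e)|$. A polytope is Forman--Ricci-positive if $\mathcal{F}(e)>0$ for every edge $e$. *)

theory Defs
  imports "HOL-Analysis.Analysis"
begin

definition two_faces_containing :: "'a::euclidean_space set \<Rightarrow> 'a set \<Rightarrow> 'a set set" where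
  "two_faces_containing P e = {F. F face_of P \<and> aff_dim F = 2 \<and> e \<subseteq> F}"

definition share_vertex :: "'a::euclidean_space set \<Rightarrow> 'a set \<Rightarrow> 'a set \<Rightarrow> bool" where
  "share_vertex P e e' \<longleftrightarrow> (\<exists>v. v extreme_point_of P \<and> v \<in> e \<and> v \<in> e')"

definition in_common_two_face :: "'a::euclidean_space set \<Rightarrow> 'a set \<Rightarrow> 'a set \<Rightarrow> bool" where
  "in_common_two_face P e e' \<longleftrightarrow>
     (\<exists>F. F face_of P \<and> aff_dim F = 2 \<and> e \<subseteq> F \<and> e' \<subseteq> F)"

definition parallel_neighbors :: "'a::euclidean_space set \<Rightarrow> 'a set \<Rightarrow> 'a set set" where
  "parallel_neighbors P e =
     {e'. e' edge_of P \<and> e' \<noteq> e \<and>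
          (share_vertex P e e' \<and> \<not> in_common_two_face P e e' \<or>
           \<not> share_vertex P e e' \<and> in_common_two_face P e e')}"

text \<open>A polytope has finitely many faces, so both cardinalities below are those of finite sets.\<close>

definition forman_ricci :: "'a::euclidean_space set \<Rightarrow> 'a set \<Rightarrow> int" where
  "forman_ricci P e = int (card (two_faces_containing P e)) + 2 - int (card (parallel_neighbors P e))"

definition forman_ricci_positive :: "'a::euclidean_space set \<Rightarrow> bool" where
  "forman_ricci_positive P \<longleftrightarrow> (\<forall>e. e edge_of P \<longrightarrow> forman_ricci P e > 0)"

text \<open>Combinatorial equivalence is isomorphism of face lattices; the faces include the empty
  face and the polytope itself.\<close>

definition comb_equiv :: "'a::euclidean_space set \<Rightarrow> 'b::euclidean_space set \<Rightarrow> bool" where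
  "comb_equiv P Q \<longleftrightarrow>
     (\<exists>f. bij_betw f {F. F face_of P} {G. G face_of Q} \<and>
          (\<forall>F F'. F face_of P \<longrightarrow> F' face_of P \<longrightarrow> (F \<subseteq> F' \<longleftrightarrow> f F \<subseteq> f F')))"

definition comb_equiv_rel :: "('a::euclidean_space set \<times> 'a set) set" where
  "comb_equiv_rel = {(P, Q). polytope P \<and> polytope Q \<and> comb_equiv P Q}"

lemma comb_equiv_refl: "comb_equiv P P"
  unfolding comb_equiv_def by (rule exI[of _ id]) auto

lemma comb_equiv_sym:
  assumes "comb_equiv P Q"
  shows "comb_equiv Q P"
proof -
  obtain f where f: "bij_betw f {F. F face_of P} {G. G face_of Q}"
    and mono: "\<And>F F'. F face_of P \<Longrightarrow> F' face_of P \<Longrightarrow> (F \<subseteq> F' \<longleftrightarrow> f F \<subseteq> f F')"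
    using assms unfolding comb_equiv_def by blast
  define g where "g = inv_into {F. F face_of P} f"
  have bij: "bij_betw g {G. G face_of Q} {F. F face_of P}"
    unfolding g_def by (rule bij_betw_inv_into[OF f])
  have gf: "g G face_of P" "f (g G) = G" if "G face_of Q" for G
    using that bij f by (auto simp: g_def bij_betw_def f_inv_into_f)
  show ?thesis
    unfolding comb_equiv_def using bij gf mono by (intro exI[of _ g]) metis
qed

lemma comb_equiv_trans:
  assumes "comb_equiv P Q" "comb_equiv Q R"
  shows "comb_equiv P R"
proof -
  obtain f where f: "bij_betw f {F. F face_of P} {G. G face_of Q}"
    and fm: "\<And>F F'. F face_of P \<Longrightarrow> F' face_of P \<Longrightarrow> (F \<subseteq> F' \<longleftrightarrow> f F \<subseteq> f F')"
    using assms(1) unfolding comb_equiv_def by blast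
  obtain g where g: "bij_betw g {F. F face_of Q} {G. G face_of R}"
    and gm: "\<And>F F'. F face_of Q \<Longrightarrow> F' face_of Q \<Longrightarrow> (F \<subseteq> F' \<longleftrightarrow> g F \<subseteq> g F')"
    using assms(2) unfolding comb_equiv_def by blast
  have fQ: "f F face_of Q" if "F face_of P" for F
    using that f by (auto simp: bij_betw_def)
  show ?thesis
    unfolding comb_equiv_def
    using bij_betw_trans[OF f g] fQ fm gm by (intro exI[of _ "g \<circ> f"]) auto
qed

lemma equiv_comb_equiv_rel: "equiv {P. polytope P} comb_equiv_rel"
  by (auto simp: equiv_def refl_on_def sym_def trans_def comb_equiv_rel_def
      intro: comb_equiv_refl comb_equiv_sym comb_equiv_trans)

end

theory Submission
  imports Defs
begin

text \<open>Let \<open>P\<close> be a Forman--Ricci-positive polytope of dimension 4. For an edge \<open>e = uv\<close> in \<open>f\<close>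
  two-faces, the parallel neighbours of \<open>e\<close> sharing a vertex with it number
  \<open>(deg u - 1 - f) + (deg v - 1 - f)\<close>, so positivity and \<open>deg v \<ge> f + 1\<close> give
  \<open>deg u \<le> 2 f + 2\<close>. Thus every vertex of the vertex figure at \<open>u\<close>, a graph on \<open>deg u\<close> vertices, is
  adjacent to at least about half of the others. That graph contains no \<open>K\<^bsub>3,3\<^esub>\<close>, which bounds \<open>deg u\<close>.

  The diameter is bounded as in the Bonnet--Myers theorem. For the graph distance \<open>g\<close> from a vertex
  \<open>u\<close>, let \<open>drift w\<close> be the sum of \<open>g w' - g w\<close> over the neighbours \<open>w'\<close> of \<open>w\<close>. Along each step of a geodesic
  from \<open>u\<close> the drift drops by at least the curvature, hence by at least 1; since it is at most
  \<open>deg u\<close> at the start and at least \<open>- deg w\<close> at the end \<open>w\<close>, the length is at most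
  \<open>deg u + deg w\<close>. Bounded degree and diameter bound the number of vertices, and the face lattice
  is determined by the vertex sets of the faces.\<close>

section \<open>Edges at a vertex\<close>

text \<open>An edge at \<open>u\<close> is encoded by its far endpoint, so degrees are cardinalities
  of point sets. The set is empty when \<open>u\<close> is not a vertex, so degree bounds can be
  stated for all points.\<close>

definition nbrs :: "'a::euclidean_space set \<Rightarrow> 'a \<Rightarrow> 'a set" where
  "nbrs P u = {w. w \<noteq> u \<and> closed_segment u w edge_of P}"

lemma polytope_eq_hull_extreme_points:
  fixes P :: "'a::euclidean_space set"
  assumes "polytope P"
  shows "P = convex hull {v. v extreme_point_of P}"
  using assms by (simp add: Krein_Milman_Minkowski polytope_imp_compact polytope_imp_convex)

lemma polytope_finite_extreme_points:
  fixes P :: "'a::euclidean_space set"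
  assumes "polytope P"
  shows "finite {v. v extreme_point_of P}"
  using assms by (simp add: finite_polyhedron_extreme_points polytope_imp_polyhedron)

lemma polytope_face_exposed:
  fixes P :: "'a::euclidean_space set"
  assumes "polytope P" "F face_of P"
  obtains a b where "\<And>x. x \<in> P \<Longrightarrow> a \<bullet> x \<le> b" "F = P \<inter> {x. a \<bullet> x = b}"
  using assms exposed_face_of_polyhedron[of P F] polytope_imp_polyhedron[of P]
  unfolding exposed_face_of_def by blast

lemma edge_of_segment:
  fixes P :: "'a::euclidean_space set"
  assumes "polytope P" "e edge_of P"
  obtains a b where "a \<noteq> b" "e = closed_segment a b"
proof -
  have e: "polytope e" "aff_dim e = 1"
    using assms face_of_polytope_polytope by (auto simp: edge_of_def)
  obtain n where n: "n simplex e"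
    using polytope_lowdim_imp_simplex[of e] e by auto
  then have "1 simplex e"
    using e aff_dim_simplex by metis
  then obtain C where C: "\<not> affine_dependent C" "int (card C) = 2" "e = convex hull C"
    by (auto simp: simplex_def)
  then obtain a b where "C = {a,b}" "a \<noteq> b"
    by (metis card_2_iff of_nat_eq_iff of_nat_numeral)
  then show ?thesis
    using that C by (metis segment_convex_hull)
qed

lemma extreme_point_of_edge:
  fixes P :: "'a::euclidean_space set"
  assumes "closed_segment u w edge_of P"
  shows "v extreme_point_of P \<and> v \<in> closed_segment u w \<longleftrightarrow> v = u \<or> v = w"
  using assms extreme_point_of_face extreme_point_of_segment edge_of_def by metis

lemma nbrs_extreme:
  assumes "w \<in> nbrs P u"
  shows "w extreme_point_of P" "u extreme_point_of P"
  using assms extreme_point_of_edge unfolding nbrs_def by blast+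

lemma nbrs_sym: "w \<in> nbrs P u \<longleftrightarrow> u \<in> nbrs P w"
  by (auto simp: nbrs_def closed_segment_commute)

lemma nbrs_irrefl [simp]: "u \<notin> nbrs P u"
  by (simp add: nbrs_def)

lemma nbrs_in: "w \<in> nbrs P u \<Longrightarrow> w \<in> P" "w \<in> nbrs P u \<Longrightarrow> u \<in> P"
  using nbrs_extreme extreme_point_of_def by blast+

lemma finite_nbrs: "polytope P \<Longrightarrow> finite (nbrs P u)"
  using finite_subset[OF _ polytope_finite_extreme_points] nbrs_extreme(1) by (metis mem_Collect_eq subsetI)

lemma edge_at_vertex:
  fixes P :: "'a::euclidean_space set"
  assumes "polytope P" "e edge_of P" "u extreme_point_of P" "u \<in> e"
  obtains w where "w \<in> nbrs P u" "e = closed_segment u w"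
proof -
  obtain a b where ab: "a \<noteq> b" "e = closed_segment a b"
    using edge_of_segment assms by blast
  then consider "u = a" | "u = b"
    using extreme_point_of_edge assms by blast
  then show ?thesis
  proof cases
    case 1
    then show ?thesis using that[of b] ab assms(2) by (simp add: nbrs_def)
  next
    case 2
    then show ?thesis using that[of a] ab assms(2) by (simp add: nbrs_def closed_segment_commute)
  qed
qed

lemma segment_subset_face:
  assumes "F face_of P" "u \<in> F" "w \<in> F"
  shows "closed_segment u w \<subseteq> F"
  using assms face_of_imp_convex closed_segment_subset by blast

lemma nbrs_face:
  assumes "F face_of P" "u \<in> F"
  shows "nbrs F u = nbrs P u \<inter> F"
  using assms segment_subset_face[OF assms] face_of_face[OF assms(1)]
  by (auto simp: nbrs_def edge_of_def)

text \<open>Take the smallest face containing \<open>q\<close>: on its relative boundary,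
  \<open>q\<close> would lie in a facet of it, against minimality.\<close>

lemma point_in_rel_interior_of_face:
  fixes P :: "'a::euclidean_space set"
  assumes "polytope P" "q \<in> P"
  obtains G where "G face_of P" "q \<in> rel_interior G"
proof -
  define G where "G = \<Inter>{F. F face_of P \<and> q \<in> F}"
  have ne: "P \<in> {F. F face_of P \<and> q \<in> F}"
    using assms face_of_refl polytope_imp_convex by auto
  have G: "G face_of P" 
    unfolding G_def using ne by (intro face_of_Inter) auto
  have q: "q \<in> G"
    unfolding G_def by auto
  have "q \<in> rel_interior G"
  proof (rule ccontr)
    assume "q \<notin> rel_interior G"
    then obtain F where F: "F facet_of G" "q \<in> F"
      using rel_boundary_of_polyhedron[of G] face_of_polytope_polytope[OF assms(1) G]
        polytope_imp_polyhedron q by blast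
    then have "F face_of P"
      using G face_of_trans facet_of_imp_face_of by blast
    then have "G \<subseteq> F" unfolding G_def using F by blast
    then have "F = G" using F facet_of_imp_subset by blast
    then show False using F by auto
  qed
  then show ?thesis using G that by blast
qed

text \<open>An extreme point of a hyperplane section separating the vertex \<open>u\<close> from all other vertices
  lies on an edge at \<open>u\<close>.\<close>

lemma improving_neighbour:
  fixes P :: "'a::euclidean_space set"
  assumes P: "polytope P" and u: "u extreme_point_of P" and y: "y \<in> P" and h: "h \<bullet> u < h \<bullet> y"
  obtains w where "w \<in> nbrs P u" "h \<bullet> u < h \<bullet> w"
proof -
  define V where "V = {v. v extreme_point_of P}"
  have fin: "finite V" using P V_def polytope_finite_extreme_points by blast
  have PV: "P = convex hull V" using P V_def polytope_eq_hull_extreme_points by blast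
  have VP: "V \<subseteq> P" by (auto simp: V_def extreme_point_of_def)
  obtain a b where ab: "\<And>x. x \<in> P \<Longrightarrow> a \<bullet> x \<le> b" "{u} = P \<inter> {x. a \<bullet> x = b}"
    using polytope_face_exposed[OF P, of "{u}"] u face_of_singleton by metis
  have aub: "a \<bullet> u = b" "u \<in> P" using ab by auto
  have lt: "a \<bullet> v < b" if "v \<in> V - {u}" for v
  proof -
    have "v \<in> P" "v \<noteq> u" using that VP by auto
    then have "a \<bullet> v \<noteq> b" using ab by blast
    then show ?thesis using ab(1)[OF \<open>v \<in> P\<close>] by auto
  qed
  obtain v0 where v0: "v0 \<in> V" "h \<bullet> u < h \<bullet> v0"
  proof (rule ccontr)
    assume "\<not> thesis"
    then have "V \<subseteq> {x. h \<bullet> x \<le> h \<bullet> u}" using that by force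
    then have "P \<subseteq> {x. h \<bullet> x \<le> h \<bullet> u}"
      using PV hull_minimal[of V _ convex] convex_halfspace_le by metis
    then show False using y h by auto
  qed
  \<comment> \<open>Every vertex other than \<open>u\<close> has \<open>a\<close>-value at most
    \<open>m\<close>, so the hyperplane at level \<open>c\<close>, strictly between \<open>m\<close>
    and \<open>b\<close>, cuts off \<open>u\<close> alone.\<close>
  define m where "m = Max ((\<lambda>v. a \<bullet> v) ` (V - {u}))"
  have ne: "V - {u} \<noteq> {}" using v0 by auto
  have m: "m < b" unfolding m_def using fin ne lt by auto
  have mle: "a \<bullet> v \<le> m" if "v \<in> V - {u}" for v
    unfolding m_def using fin that by auto
  define c where "c = (m + b) / 2"
  have c: "c < b" "m < c" using m by (auto simp: c_def)
  define Q where "Q = P \<inter> {x. a \<bullet> x = c}"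
  have Q: "polytope Q" unfolding Q_def using P polyhedron_hyperplane polytope_Int_polyhedron by blast
  \<comment> \<open>\<open>t\<close> makes \<open>z\<close> the point where the segment from
    \<open>u\<close> to \<open>v0\<close> meets the hyperplane; there \<open>h\<close> already
    exceeds its value at \<open>u\<close>.\<close>
  define t where "t = (b - c) / (b - a \<bullet> v0)"
  have v0': "v0 \<in> V - {u}" using v0 by auto
  have t: "0 < t" "t \<le> 1" using mle[OF v0'] lt[OF v0'] c by (auto simp: t_def)
  define z where "z = u + t *\<^sub>R (v0 - u)"
  have "z = (1 - t) *\<^sub>R u + t *\<^sub>R v0" by (simp add: z_def algebra_simps)
  then have "z \<in> closed_segment u v0" using t by (auto simp: closed_segment_def)
  then have zP: "z \<in> P"
    using aub v0 VP P polytope_imp_convex closed_segment_subset[of u P v0] by blast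
  have "a \<bullet> z = b - t * (b - a \<bullet> v0)"
    using aub by (simp add: z_def inner_add_right inner_diff_right algebra_simps)
  also have "\<dots> = c" using lt[OF v0'] by (simp add: t_def)
  finally have zQ: "z \<in> Q" using zP by (simp add: Q_def)
  have hz: "h \<bullet> z > h \<bullet> u"
    using v0 t by (simp add: z_def inner_add_right inner_diff_right)
  obtain q where q: "q extreme_point_of Q" "h \<bullet> u < h \<bullet> q"
  proof (rule ccontr)
    assume "\<not> thesis"
    then have "{v. v extreme_point_of Q} \<subseteq> {x. h \<bullet> x \<le> h \<bullet> u}" using that by force
    then have "Q \<subseteq> {x. h \<bullet> x \<le> h \<bullet> u}"
      using polytope_eq_hull_extreme_points[OF Q] hull_minimal[of _ _ convex] convex_halfspace_le by metis
    then show False using zQ hz by auto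
  qed
  have qP: "q \<in> P" "a \<bullet> q = c" using q by (auto simp: extreme_point_of_def Q_def)
  \<comment> \<open>\<open>G\<close> will be the edge sought. As \<open>q\<close> is both extreme in
    and relatively interior to the section \<open>G \<inter> H\<close>, that section is the single
    point \<open>q\<close>.\<close>
  obtain G where G: "G face_of P" "q \<in> rel_interior G"
    using point_in_rel_interior_of_face P qP by metis
  have qG: "q \<in> G" using G rel_interior_subset by blast
  define H where "H = {x. a \<bullet> x = c}"
  have "(G \<inter> H) \<inter> Q = G \<inter> H" using G face_of_imp_subset by (auto simp: Q_def H_def)
  then have "q extreme_point_of (G \<inter> H)"
    using q qG qP unfolding extreme_point_of_def H_def by auto
  moreover have "q \<in> rel_interior (G \<inter> H)"
    using convex_affine_rel_interior_Int[of G H] G qP face_of_imp_convex affine_hyperplane[of a c]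
    unfolding H_def by blast
  ultimately have GH: "G \<inter> H = {q}" using extreme_point_not_in_REL_INTERIOR by blast
  \<comment> \<open>Near \<open>q\<close> the affine hull of \<open>G\<close> stays inside
    \<open>G\<close>, so \<open>L\<close> reduces to \<open>q\<close> there and has dimension at
    most 0. A hyperplane lowers dimension by at most one, whence
    \<open>aff_dim G \<le> 1\<close>.\<close>
  obtain T where T: "open T" "q \<in> T" "T \<inter> affine hull G \<subseteq> G"
    using G mem_rel_interior by blast
  define L where "L = affine hull G \<inter> H"
  have qL: "q \<in> L" using qG qP hull_inc by (auto simp: L_def H_def)
  have "L \<inter> T \<subseteq> {q}" using T GH by (auto simp: L_def)
  then have "aff_dim (L \<inter> T) \<le> 0" by (metis aff_dim_sing aff_dim_subset)
  moreover have "aff_dim (L \<inter> T) = aff_dim L"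
    by (rule aff_dim_convex_Int_open)
      (use T qL in \<open>auto simp: L_def H_def affine_hyperplane affine_Int affine_imp_convex\<close>)
  ultimately have "aff_dim L \<le> 0" by simp
  moreover have "aff_dim L \<ge> aff_dim G - 1"
    unfolding L_def H_def
    using aff_dim_affine_Int_hyperplane[of "affine hull G" a c] qL
    by (auto simp: L_def H_def aff_dim_affine_hull split: if_splits)
  ultimately have "aff_dim G \<le> 1" by simp
  \<comment> \<open>At a vertex \<open>a\<close> takes the value \<open>b\<close> or a value at most
    \<open>m\<close>, never \<open>c\<close>; this excludes dimension 0 for
    \<open>G\<close>.\<close>
  moreover have "q \<notin> V" 
  proof
    assume "q \<in> V"
    then show False using mle[of q] c qP aub by (cases "q = u") auto
  qed
  moreover have "aff_dim G \<noteq> 0"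
  proof
    assume "aff_dim G = 0"
    then have "G = {q}" using qG by (auto simp: aff_dim_eq_0)
    then have "q \<in> V" using G by (simp add: V_def face_of_singleton)
    then show False using \<open>q \<notin> V\<close> by simp
  qed
  moreover have "aff_dim G \<ge> 0" using qG aff_dim_negative_iff[of G] by (metis empty_iff not_le)
  ultimately have Ge: "G edge_of P" using G by (auto simp: edge_of_def)
  have "u \<in> G"
  proof (rule ccontr)
    assume "u \<notin> G"
    then have "{v. v extreme_point_of G} \<subseteq> {x. a \<bullet> x \<le> m}"
      using mle extreme_point_of_face[OF G(1)] V_def by blast
    then have "G \<subseteq> {x. a \<bullet> x \<le> m}"
      using polytope_eq_hull_extreme_points[OF face_of_polytope_polytope[OF P G(1)]]
        hull_minimal[of _ _ convex] convex_halfspace_le by metis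
    then show False using qG qP c by auto
  qed
  then obtain w where w: "w \<in> nbrs P u" "G = closed_segment u w"
    using edge_at_vertex P Ge u by metis
  have "h \<bullet> u < h \<bullet> w"
  proof -
    obtain s where s: "0 \<le> s" "s \<le> 1" "q = (1 - s) *\<^sub>R u + s *\<^sub>R w"
      using w qG by (auto simp: closed_segment_def)
    have "h \<bullet> q - h \<bullet> u = s * (h \<bullet> w - h \<bullet> u)"
      by (simp add: s inner_add_right algebra_simps)
    then have "s * (h \<bullet> w - h \<bullet> u) > 0" using q by simp
    then show ?thesis using s by (simp add: zero_less_mult_iff)
  qed
  then show ?thesis using w that by blast
qed

section \<open>Linear relations between edge directions\<close>

lemma linear_relation_exists:
  fixes S :: "'a::euclidean_space set"
  assumes "T \<subseteq> S" "finite T" "u \<in> S" "aff_dim S < int (card T)"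
  obtains l where "\<exists>x\<in>T. l x \<noteq> 0" "(\<Sum>x\<in>T. l x *\<^sub>R (x - u)) = 0"
proof -
  define D where "D = (\<lambda>x. x - u) ` T"
  have inj: "inj_on (\<lambda>x. x - u) T" by (simp add: inj_on_def)
  have "int (dim D) \<le> int (dim ((\<lambda>x. x - u) ` S))"
    unfolding D_def using assms by (simp add: dim_subset image_mono)
  also have "\<dots> = aff_dim S"
    using aff_dim_eq_dim_subtract[of u S] assms hull_inc by metis
  also have "\<dots> < int (card D)"
    using inj assms by (simp add: D_def card_image)
  finally have "dependent D"
    by (intro dependent_biggerset_general) simp
  moreover have "finite D" using assms by (simp add: D_def)
  ultimately obtain c where c: "\<exists>v\<in>D. c v \<noteq> 0" "(\<Sum>v\<in>D. c v *\<^sub>R v) = 0"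
    using dependent_finite by blast
  have "(\<Sum>x\<in>T. c (x - u) *\<^sub>R (x - u)) = 0"
    using c(2) unfolding D_def sum.reindex[OF inj] by simp
  moreover have "\<exists>x\<in>T. c (x - u) \<noteq> 0"
    using c(1) unfolding D_def by auto
  ultimately show ?thesis using that[of "\<lambda>x. c (x - u)"] by blast
qed

text \<open>Pair the relation with a functional exposing \<open>F\<close>. Positive coefficients
  contribute 0, the others a product of two nonpositive numbers; the sum is 0, so every term
  vanishes.\<close>

lemma relation_support_in_face:
  fixes P :: "'a::euclidean_space set"
  assumes P: "polytope P" and F: "F face_of P" and T: "T \<subseteq> P" "finite T" and u: "u \<in> F"
    and rel: "(\<Sum>x\<in>T. l x *\<^sub>R (x - u)) = 0"
    and pos: "{x \<in> T. l x > 0} \<subseteq> F"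
  shows "{x \<in> T. l x \<noteq> 0} \<subseteq> F"
proof -
  obtain a b where ab: "\<And>x. x \<in> P \<Longrightarrow> a \<bullet> x \<le> b" "F = P \<inter> {x. a \<bullet> x = b}"
    using polytope_face_exposed P F by metis
  have au: "a \<bullet> u = b" using ab u by auto
  have "0 = a \<bullet> (\<Sum>x\<in>T. l x *\<^sub>R (x - u))" using rel by simp
  also have "\<dots> = (\<Sum>x\<in>T. l x * (a \<bullet> x - b))"
    by (simp add: inner_sum_right inner_diff_right au)
  finally have "(\<Sum>x\<in>T. l x * (a \<bullet> x - b)) = 0" by simp
  moreover have "l x * (a \<bullet> x - b) \<ge> 0" if "x \<in> T" for x
  proof (cases "l x > 0")
    case True
    then show ?thesis using pos ab that by force
  next
    case False
    then show ?thesis using ab(1)[of x] that T by (simp add: mult_nonpos_nonpos subset_iff)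
  qed
  ultimately have "\<forall>x\<in>T. l x * (a \<bullet> x - b) = 0"
    using sum_nonneg_eq_0_iff[of T "\<lambda>x. l x * (a \<bullet> x - b)"] T by blast
  then show ?thesis using ab T by auto
qed

text \<open>With at most one positive coefficient, the whole support lies in the vertex
  \<open>u\<close> or in one edge at \<open>u\<close>. That leaves at most one edge direction, and a
  nonzero vector alone satisfies no relation.\<close>

lemma relation_card_pos:
  fixes P :: "'a::euclidean_space set"
  assumes P: "polytope P" and T: "T \<subseteq> nbrs P u" 
    and rel: "(\<Sum>x\<in>T. l x *\<^sub>R (x - u)) = 0"
    and nz: "\<exists>x\<in>T. l x \<noteq> 0"
  shows "card {x \<in> T. l x > 0} \<ge> 2"
proof (rule ccontr)
  assume small: "\<not> ?thesis"
  have fin: "finite T" using T P finite_nbrs finite_subset by blast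
  have TP: "T \<subseteq> P" using T nbrs_in by blast
  have u: "u extreme_point_of P" using T nz nbrs_extreme by blast
  have "card {x \<in> T. l x > 0} = 0 \<or> card {x \<in> T. l x > 0} = 1"
    using small by linarith
  then consider "{x \<in> T. l x > 0} = {}" | y where "{x \<in> T. l x > 0} = {y}"
    using fin card_1_singletonE by force
  then show False
  proof cases
    case 1
    then have "{x \<in> T. l x \<noteq> 0} \<subseteq> {u}"
      using relation_support_in_face[of P "{u}" T u l] P u face_of_singleton TP fin rel by auto
    then show False using nz T nbrs_irrefl by blast
  next
    case 2
    then have y: "y \<in> nbrs P u" "y \<in> T" "l y > 0" using T by auto
    have "{x \<in> T. l x \<noteq> 0} \<subseteq> closed_segment u y"
      using relation_support_in_face[of P "closed_segment u y" T u l] P y TP fin rel 2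
      by (auto simp: nbrs_def edge_of_def)
    then have sup: "{x \<in> T. l x \<noteq> 0} \<subseteq> {y}"
      using extreme_point_of_edge[of u y P] y(1) T nbrs_extreme(1)[of _ P u] nbrs_irrefl
      unfolding nbrs_def by blast
    have "(\<Sum>x\<in>T. l x *\<^sub>R (x - u)) = (\<Sum>x\<in>{y}. l x *\<^sub>R (x - u))"
      by (rule sum.mono_neutral_right) (use fin y sup in auto)
    then show False using rel y nbrs_irrefl by auto
  qed
qed

lemma relation_card_neg:
  fixes P :: "'a::euclidean_space set"
  assumes P: "polytope P" and T: "T \<subseteq> nbrs P u" 
    and rel: "(\<Sum>x\<in>T. l x *\<^sub>R (x - u)) = 0"
    and nz: "\<exists>x\<in>T. l x \<noteq> 0"
  shows "card {x \<in> T. l x < 0} \<ge> 2"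
  using relation_card_pos[OF P T, of "\<lambda>x. - l x"] rel nz by (simp add: sum_negf)

lemma relation_card_support:
  fixes P :: "'a::euclidean_space set"
  assumes P: "polytope P" and T: "T \<subseteq> nbrs P u" 
    and rel: "(\<Sum>x\<in>T. l x *\<^sub>R (x - u)) = 0"
    and nz: "\<exists>x\<in>T. l x \<noteq> 0"
  shows "card {x \<in> T. l x \<noteq> 0} \<ge> 4"
proof -
  have fin: "finite T" using T P finite_nbrs finite_subset by blast
  have "{x \<in> T. l x \<noteq> 0} = {x \<in> T. l x > 0} \<union> {x \<in> T. l x < 0}" by auto
  then have "card {x \<in> T. l x \<noteq> 0} = card {x \<in> T. l x > 0} + card {x \<in> T. l x < 0}"
    using fin by (simp add: card_Un_disjoint disjoint_iff)
  then show ?thesis using relation_card_pos[OF assms] relation_card_neg[OF assms] by linarith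
qed

section \<open>Two-dimensional faces and their edges\<close>

text \<open>A proper face of a two-face has dimension at most 1, so the only edge it can contain is
  itself.\<close>

lemma face_eq_if_distinct_edges:
  fixes P :: "'a::euclidean_space set"
  assumes P: "polytope P" and F: "F face_of P" "G face_of P" and "aff_dim G = 2" "F \<subseteq> G"
    and e: "e edge_of P" "e' edge_of P" "e \<noteq> e'" "e \<subseteq> F" "e' \<subseteq> F"
  shows "F = G"
proof (rule ccontr)
  assume "F \<noteq> G"
  have conv: "convex F" "convex G" using F face_of_imp_convex by auto
  have "F face_of G" using F assms face_of_face by blast
  then have "aff_dim F < 2"
    using face_of_aff_dim_lt conv \<open>F \<noteq> G\<close> assms by metis
  have *: "f = F" if "f edge_of P" "f \<subseteq> F" for f
  proof (rule ccontr)
    assume "f \<noteq> F"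
    have "f face_of F" using that F face_of_face by (auto simp: edge_of_def)
    then have "aff_dim f < aff_dim F" using face_of_aff_dim_lt conv \<open>f \<noteq> F\<close> by blast
    then show False using that \<open>aff_dim F < 2\<close> by (simp add: edge_of_def)
  qed
  show False using * e by blast
qed

text \<open>The face \<open>F \<inter> G\<close> contains both edges, so it equals each of
  \<open>F\<close> and \<open>G\<close>.\<close>

lemma two_face_unique:
  fixes P :: "'a::euclidean_space set"
  assumes P: "polytope P" and F: "F face_of P" "aff_dim F = 2" and G: "G face_of P" "aff_dim G = 2"
    and e: "e edge_of P" "e' edge_of P" "e \<noteq> e'" "e \<subseteq> F" "e' \<subseteq> F" "e \<subseteq> G" "e' \<subseteq> G"
  shows "F = G"
  using face_eq_if_distinct_edges[OF P, of "F \<inter> G" F e e']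
    face_eq_if_distinct_edges[OF P, of "F \<inter> G" G e e'] face_of_Int[of F P G] assms by auto

text \<open>Three edge directions in a plane would satisfy a nontrivial relation, but its support
  needs four elements. If there were at most one edge at \<open>u\<close>, a functional constant
  along it and increasing towards another point of \<open>F\<close> would contradict
  \<open>improving_neighbour\<close>.\<close>

lemma card_nbrs_two_face:
  fixes P :: "'a::euclidean_space set"
  assumes P: "polytope P" and F: "F face_of P" "aff_dim F = 2"
    and u: "u extreme_point_of P" "u \<in> F"
  shows "card (nbrs P u \<inter> F) = 2"
proof -
  have fin: "finite (nbrs P u)" using finite_nbrs P by blast
  have poly: "polytope F" using F P face_of_polytope_polytope by blast
  have nF: "nbrs F u = nbrs P u \<inter> F" using nbrs_face[OF F(1) u(2)] .
  have "card (nbrs F u) \<le> 2"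
  proof (rule ccontr)
    assume "\<not> ?thesis"
    then obtain T where T: "T \<subseteq> nbrs F u" "card T = 3" "finite T"
      using obtain_subset_with_card_n[of 3 "nbrs F u"] by auto
    then have TF: "T \<subseteq> F" using nF by blast
    obtain l where l: "\<exists>x\<in>T. l x \<noteq> 0" "(\<Sum>x\<in>T. l x *\<^sub>R (x - u)) = 0"
      using linear_relation_exists[OF TF T(3) u(2)] F T(2) by auto
    have "4 \<le> card {x \<in> T. l x \<noteq> 0}"
      using relation_card_support[OF poly T(1) l(2) l(1)] .
    also have "\<dots> \<le> card T" by (rule card_mono) (use T in auto)
    finally show False using T by simp
  qed
  moreover have "card (nbrs F u) \<ge> 2"
  proof (rule ccontr)
    assume "\<not> ?thesis"
    then have "card (nbrs F u) \<le> 1" by simp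
    then have "\<forall>a\<in>nbrs F u. \<forall>b\<in>nbrs F u. a = b"
      using card_le_Suc0_iff_eq[OF finite_nbrs[OF poly]] by simp
    then obtain x where x: "nbrs F u \<subseteq> {x}"
      by (metis insertCI subsetI)
    have "\<not> F \<subseteq> affine hull {u, x}"
    proof
      assume "F \<subseteq> affine hull {u, x}"
      then have "aff_dim F \<le> aff_dim {u, x}" by (metis aff_dim_affine_hull aff_dim_subset)
      then show False using F aff_dim_2[of u x] by (simp split: if_splits)
    qed
    then obtain y where y: "y \<in> F" "y \<notin> affine hull {u, x}" by blast
    define d where "d = x - u"
    \<comment> \<open>The component of \<open>y - u\<close> orthogonal to \<open>d\<close>. If there
      are no neighbours, \<open>x\<close> is arbitrary and \<open>d\<close> may be 0; then
      \<open>h\<close> is \<open>y - u\<close> itself.\<close>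
    define h where "h = (y - u) - (((y - u) \<bullet> d) / (d \<bullet> d)) *\<^sub>R d"
    have hd: "h \<bullet> d = 0" by (cases "d = 0") (auto simp: h_def inner_diff_left)
    have "h \<noteq> 0"
    proof
      assume "h = 0"
      then have "y = u + (((y - u) \<bullet> d) / (d \<bullet> d)) *\<^sub>R (x - u)"
        unfolding h_def d_def by (simp add: algebra_simps)
      then have "y \<in> affine hull {u, x}"
        unfolding affine_hull_2_alt by blast
      then show False using y by simp
    qed
    have "h \<bullet> (y - u) = h \<bullet> (h + (((y - u) \<bullet> d) / (d \<bullet> d)) *\<^sub>R d)"
      by (simp add: h_def)
    also have "\<dots> = h \<bullet> h" using hd by (simp add: inner_add_right)
    finally have "h \<bullet> (y - u) = h \<bullet> h" .
    moreover have "h \<bullet> h > 0" using \<open>h \<noteq> 0\<close> by simp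
    ultimately have "h \<bullet> u < h \<bullet> y" unfolding inner_diff_right by linarith
    moreover have "u extreme_point_of F" using u F extreme_point_of_face by blast
    ultimately obtain w where w: "w \<in> nbrs F u" "h \<bullet> u < h \<bullet> w"
      using improving_neighbour poly y by metis
    then have "w = x" using x by blast
    then show False using w hd by (simp add: d_def inner_diff_right)
  qed
  ultimately show ?thesis using nF by simp
qed

section \<open>The graph of the vertex figure\<close>

text \<open>Adjacency in the graph of the vertex figure at \<open>u\<close>: its vertices are the
  edges of \<open>P\<close> at \<open>u\<close>, its edges the two-faces at
  \<open>u\<close>.\<close>

definition linked :: "'a::euclidean_space set \<Rightarrow> 'a \<Rightarrow> 'a \<Rightarrow> 'a \<Rightarrow> bool" where
  "linked P u x y \<longleftrightarrow> x \<in> nbrs P u \<and> y \<in> nbrs P u \<and> x \<noteq> y \<and>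
     (\<exists>F. F face_of P \<and> aff_dim F = 2 \<and> u \<in> F \<and> x \<in> F \<and> y \<in> F)"

text \<open>The two-face through \<open>x\<close> and \<open>a\<close> would absorb the whole
  support, which has at least four elements, while only two neighbours of \<open>u\<close> lie in
  it.\<close>

lemma relation_not_in_two_face:
  fixes P :: "'a::euclidean_space set"
  assumes P: "polytope P" and T: "T \<subseteq> nbrs P u" 
    and rel: "(\<Sum>x\<in>T. l x *\<^sub>R (x - u)) = 0" and nz: "\<exists>x\<in>T. l x \<noteq> 0"
    and xa: "linked P u x a" and pos: "{y \<in> T. l y > 0} \<subseteq> {x, a}"
  shows False
proof -
  obtain F where F: "F face_of P" "aff_dim F = 2" "u \<in> F" "x \<in> F" "a \<in> F"
    using xa by (auto simp: linked_def)
  have u: "u extreme_point_of P" using T nz nbrs_extreme by blast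
  have fin: "finite T" using T P finite_nbrs finite_subset by blast
  have "T \<subseteq> P" using T nbrs_in by blast
  then have "{x \<in> T. l x \<noteq> 0} \<subseteq> F"
    using relation_support_in_face[OF P F(1) _ fin F(3) rel] pos F by blast
  then have "card {x \<in> T. l x \<noteq> 0} \<le> card (nbrs P u \<inter> F)"
    using T finite_nbrs[OF P] by (intro card_mono) auto
  also have "\<dots> = 2" using card_nbrs_two_face[OF P F(1,2) u F(3)] .
  finally show False using relation_card_support[OF P T rel nz] by simp
qed

text \<open>Among three coefficients on \<open>X\<close>, one strict sign occurs at most once.
  Together with \<open>a\<close> for the positive sign, or \<open>b\<close> for the negative one,
  that sign class lies in a linked pair.\<close>

lemma signed_relation_contradiction:
  fixes P :: "'a::euclidean_space set"
  assumes P: "polytope P" and X: "card X = 3" and ab: "a \<notin> X" "b \<notin> X" "a \<noteq> b"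
    and lk: "\<And>x. x \<in> X \<Longrightarrow> linked P u x a" "\<And>x. x \<in> X \<Longrightarrow> linked P u x b"
    and rel: "l a *\<^sub>R (a - u) + l b *\<^sub>R (b - u) + (\<Sum>x\<in>X. l x *\<^sub>R (x - u)) = 0"
    and nz: "l a \<noteq> 0 \<or> l b \<noteq> 0 \<or> (\<exists>x\<in>X. l x \<noteq> 0)" and sgn: "l a \<ge> 0" "l b \<le> 0"
  shows False
proof -
  define T where "T = insert a (insert b X)"
  have finX: "finite X" using X card.infinite by fastforce
  obtain x1 where x1: "x1 \<in> X" using X by fastforce
  have T: "T \<subseteq> nbrs P u" using lk x1 by (auto simp: T_def linked_def)
  have rel': "(\<Sum>x\<in>T. l x *\<^sub>R (x - u)) = 0" and nz': "\<exists>x\<in>T. l x \<noteq> 0"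
    using rel nz ab finX by (auto simp: T_def algebra_simps)
  define A where "A = {x \<in> X. l x > 0}"
  define B where "B = {x \<in> X. l x < 0}"
  have "card A + card B = card (A \<union> B)"
    using finX by (intro card_Un_disjoint[symmetric]) (auto simp: A_def B_def)
  also have "\<dots> \<le> card X" using finX by (intro card_mono) (auto simp: A_def B_def)
  finally have "card A \<le> Suc 0 \<or> card B \<le> Suc 0" using X by linarith
  moreover have fin: "finite A" "finite B" using finX by (auto simp: A_def B_def)
  ultimately have "(\<forall>x\<in>A. \<forall>y\<in>A. x = y) \<or> (\<forall>x\<in>B. \<forall>y\<in>B. x = y)"
    using card_le_Suc0_iff_eq by metis
  \<comment> \<open>When the sign class is empty, \<open>x1\<close> serves as
    \<open>x\<close>.\<close>
  then have "(\<exists>x\<in>X. A \<subseteq> {x}) \<or> (\<exists>x\<in>X. B \<subseteq> {x})"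
    using x1 unfolding A_def B_def by blast
  then consider x where "x \<in> X" "A \<subseteq> {x}" | x where "x \<in> X" "B \<subseteq> {x}" by blast
  then show False
  proof cases
    case 1
    then have "{y \<in> T. l y > 0} \<subseteq> {x, a}" using sgn by (auto simp: T_def A_def)
    then show False using relation_not_in_two_face[OF P T rel' nz' lk(1)[OF 1(1)]] by blast
  next
    case 2
    then have "{y \<in> T. - l y > 0} \<subseteq> {x, b}" using sgn by (auto simp: T_def B_def)
    moreover have "(\<Sum>x\<in>T. (- l x) *\<^sub>R (x - u)) = 0" "\<exists>x\<in>T. - l x \<noteq> 0"
      using rel' nz' by (auto simp: sum_negf)
    ultimately show False using relation_not_in_two_face[OF P T, of "\<lambda>x. - l x"] lk(2)[OF 2(1)] by blast
  qed
qed

text \<open>Otherwise the two coefficients have weakly opposite signs, zero included, and the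
  preceding lemma applies to \<open>a\<close>, \<open>b\<close> in one of the two orders.\<close>

lemma relation_same_sign:
  fixes P :: "'a::euclidean_space set"
  assumes P: "polytope P" and X: "card X = 3" and ab: "a \<notin> X" "b \<notin> X" "a \<noteq> b"
    and lk: "\<And>x. x \<in> X \<Longrightarrow> linked P u x a" "\<And>x. x \<in> X \<Longrightarrow> linked P u x b"
    and rel: "l a *\<^sub>R (a - u) + l b *\<^sub>R (b - u) + (\<Sum>x\<in>X. l x *\<^sub>R (x - u)) = 0"
    and nz: "l a \<noteq> 0 \<or> l b \<noteq> 0 \<or> (\<exists>x\<in>X. l x \<noteq> 0)"
  shows "l a * l b > 0"
proof (rule ccontr)
  assume "\<not> ?thesis"
  then have "(l a \<ge> 0 \<and> l b \<le> 0) \<or> (l b \<ge> 0 \<and> l a \<le> 0)"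
    unfolding zero_less_mult_iff by linarith
  moreover have "\<not> (l a \<ge> 0 \<and> l b \<le> 0)"
    using signed_relation_contradiction[OF P X ab lk rel nz] by blast
  moreover have "\<not> (l b \<ge> 0 \<and> l a \<le> 0)"
  proof -
    have "l b *\<^sub>R (b - u) + l a *\<^sub>R (a - u) + (\<Sum>x\<in>X. l x *\<^sub>R (x - u)) = 0"
      using rel by (simp only: add.commute)
    then show ?thesis
      using signed_relation_contradiction[OF P X ab(2,1) ab(3)[symmetric] lk(2,1)] nz by blast
  qed
  ultimately show False by blast
qed

text \<open>The vertex figure of a 4-polytope has a planar graph, hence contains no \<open>K\<^bsub>3,3\<^esub>\<close>. The
  elementary reason: modulo the span of the three directions in \<open>X\<close> the space is a line, so two of
  three common neighbours lie weakly on the same side of it.\<close>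

lemma card_common_linked_le_2:
  fixes P :: "'a::euclidean_space set"
  assumes P: "polytope P" and dim: "aff_dim P \<le> 4" and X: "card X = 3"
  shows "card {a. \<forall>x\<in>X. linked P u x a} \<le> 2"
proof (rule ccontr)
  assume "\<not> ?thesis"
  then have "3 \<le> card {a. \<forall>x\<in>X. linked P u x a}" by linarith
  then obtain A where A: "A \<subseteq> {a. \<forall>x\<in>X. linked P u x a}" "card A = 3"
    by (rule obtain_subset_with_card_n)
  then obtain a b c where abc: "A = {a, b, c}" "a \<noteq> b" "b \<noteq> c" "a \<noteq> c"
    unfolding card_3_iff by blast
  obtain x1 where x1: "x1 \<in> X" using X by fastforce
  have finX: "finite X" using X card.infinite by fastforce
  have lk: "linked P u x a" "linked P u x b" "linked P u x c" if "x \<in> X" for x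
    using A(1) that unfolding abc(1) by auto
  then have nX: "a \<notin> X" "b \<notin> X" "c \<notin> X" by (auto simp: linked_def)
  have nb: "a \<in> nbrs P u" "b \<in> nbrs P u" "c \<in> nbrs P u" "X \<subseteq> nbrs P u"
    using lk x1 by (auto simp: linked_def)
  have uP: "u \<in> P" using nb nbrs_in by blast
  \<comment> \<open>Five directions in dimension at most 4 are dependent.\<close>
  have ex: "\<exists>l. l p *\<^sub>R (p - u) + l q *\<^sub>R (q - u) + (\<Sum>x\<in>X. l x *\<^sub>R (x - u)) = 0
      \<and> (l p \<noteq> 0 \<or> l q \<noteq> 0 \<or> (\<exists>x\<in>X. l x \<noteq> 0))"
    if "p \<noteq> q" "p \<notin> X" "q \<notin> X" "p \<in> nbrs P u" "q \<in> nbrs P u" for p q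
  proof -
    have sub: "insert p (insert q X) \<subseteq> P" using nb that nbrs_in by blast
    have "card (insert p (insert q X)) = 5" using that X finX by simp
    then obtain l where "\<exists>x\<in>insert p (insert q X). l x \<noteq> 0"
      "(\<Sum>x\<in>insert p (insert q X). l x *\<^sub>R (x - u)) = 0"
      using linear_relation_exists[OF sub _ uP] finX dim by auto
    then show ?thesis using that finX by (intro exI[of _ l]) (auto simp: add.assoc)
  qed
  obtain l where l: "l a *\<^sub>R (a - u) + l b *\<^sub>R (b - u) + (\<Sum>x\<in>X. l x *\<^sub>R (x - u)) = 0"
      "l a \<noteq> 0 \<or> l b \<noteq> 0 \<or> (\<exists>x\<in>X. l x \<noteq> 0)"
    using ex[OF abc(2) nX(1,2) nb(1,2)] by blast
  obtain m where m: "m b *\<^sub>R (b - u) + m c *\<^sub>R (c - u) + (\<Sum>x\<in>X. m x *\<^sub>R (x - u)) = 0"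
      "m b \<noteq> 0 \<or> m c \<noteq> 0 \<or> (\<exists>x\<in>X. m x \<noteq> 0)"
    using ex[OF abc(3) nX(2,3) nb(2,3)] by blast
  have lab: "l a * l b > 0"
    using relation_same_sign[OF P X nX(1,2) abc(2) lk(1,2) l] by blast
  have mbc: "m b * m c > 0"
    using relation_same_sign[OF P X nX(2,3) abc(3) lk(2,3) m] by blast
  \<comment> \<open>\<open>m b\<close> times the first relation minus \<open>l b\<close> times the
    second eliminates \<open>b\<close>. The extra factor \<open>m b * l b\<close> turns the outer
    coefficients into squares times \<open>l a * l b\<close> and \<open>m b * m c\<close>, which
    makes \<open>n a\<close> positive and \<open>n c\<close> negative.\<close>
  define n where "n = (\<lambda>x. if x = a then m b * l a * (m b * l b) else if x = c then - l b * m c * (m b * l b)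
     else (m b * l x - l b * m x) * (m b * l b))"
  have na: "n a = m b * l a * (m b * l b)" and nc: "n c = - l b * m c * (m b * l b)"
    and nx: "\<And>x. x \<in> X \<Longrightarrow> n x = (m b * l x - l b * m x) * (m b * l b)"
    using abc nX by (auto simp: n_def)
  define L where "L = (\<Sum>x\<in>X. l x *\<^sub>R (x - u))"
  define M where "M = (\<Sum>x\<in>X. m x *\<^sub>R (x - u))"
  have "(\<Sum>x\<in>X. n x *\<^sub>R (x - u))
      = (\<Sum>x\<in>X. (m b * l b) *\<^sub>R (m b *\<^sub>R l x *\<^sub>R (x - u) - l b *\<^sub>R m x *\<^sub>R (x - u)))"
    by (rule sum.cong[OF refl]) (simp add: nx flip: scaleR_diff_left)
  also have "\<dots> = (m b * l b) *\<^sub>R (m b *\<^sub>R L - l b *\<^sub>R M)"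
    by (simp add: L_def M_def sum_subtractf scaleR_sum_right scaleR_diff_right)
  finally have N: "(\<Sum>x\<in>X. n x *\<^sub>R (x - u)) = (m b * l b) *\<^sub>R (m b *\<^sub>R L - l b *\<^sub>R M)" .
  have "L = - (l a *\<^sub>R (a - u) + l b *\<^sub>R (b - u))" "M = - (m b *\<^sub>R (b - u) + m c *\<^sub>R (c - u))"
    using l(1) m(1) unfolding L_def M_def eq_neg_iff_add_eq_0 by (simp_all only: add.commute)
  then have rel: "n a *\<^sub>R (a - u) + n c *\<^sub>R (c - u) + (\<Sum>x\<in>X. n x *\<^sub>R (x - u)) = 0"
    unfolding N na nc by (simp add: scaleR_add_right scaleR_diff_right mult_ac)
  have "n a = (m b)\<^sup>2 * (l a * l b)" by (simp add: na power2_eq_square)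
  then have "n a > 0" using lab mbc by (auto simp: zero_less_mult_iff)
  moreover have "n c = - ((l b)\<^sup>2 * (m b * m c))" by (simp add: nc power2_eq_square)
  then have "n c < 0" using lab mbc by (auto simp: zero_less_mult_iff mult_less_0_iff)
  ultimately show False
    using signed_relation_contradiction[OF P X nX(1,3) abc(4) lk(1,3) rel] by auto
qed

text \<open>Double counting of the pairs between \<open>N\<close> and five of its elements: at most
  \<open>2 * (5 choose 3)\<close> elements of \<open>N\<close> are related to three or more of the five.\<close>

lemma K33_free_dense_card_bound:
  assumes fin: "finite N" and dense: "\<And>x. x \<in> N \<Longrightarrow> card N \<le> 2 * card {a \<in> N. R x a} + 2"
    and K33: "\<And>X. X \<subseteq> N \<Longrightarrow> card X = 3 \<Longrightarrow> card {a \<in> N. \<forall>x\<in>X. R x a} \<le> 2"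
  shows "card N \<le> 130"
proof (cases "5 \<le> card N")
  case True
  \<comment> \<open>With \<open>S\<close> the number of related pairs between \<open>W\<close> and
    \<open>N\<close>, density gives \<open>5 * card N \<le> 2 * S + 10\<close>. Elements outside
    \<open>B\<close> lie in at most 2 pairs and the at most 20 elements of \<open>B\<close> in at
    most 5, so \<open>S \<le> 2 * card N + 60\<close>. Five is the least size of \<open>W\<close>
    for which \<open>card N\<close> does not cancel.\<close>
  then obtain W where W: "W \<subseteq> N" "card W = 5" "finite W"
    by (rule obtain_subset_with_card_n)
  define B where "B = {a \<in> N. 3 \<le> card {x \<in> W. R x a}}"
  define TT where "TT = {X. X \<subseteq> W \<and> card X = 3}"
  have "card TT = 5 choose 3" unfolding TT_def using n_subsets[OF W(3)] W(2) by metis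
  then have cardT: "card TT = 10" by (simp add: eval_nat_numeral)
  have "B \<subseteq> (\<Union>X\<in>TT. {a \<in> N. \<forall>x\<in>X. R x a})"
  proof
    fix a assume a: "a \<in> B"
    then have "3 \<le> card {x \<in> W. R x a}" by (simp add: B_def)
    then obtain X where "X \<subseteq> {x \<in> W. R x a}" "card X = 3"
      by (rule obtain_subset_with_card_n)
    then show "a \<in> (\<Union>X\<in>TT. {a \<in> N. \<forall>x\<in>X. R x a})"
      using a unfolding B_def TT_def by blast
  qed
  then have "card B \<le> card (\<Union>X\<in>TT. {a \<in> N. \<forall>x\<in>X. R x a})"
    using fin W by (intro card_mono) (auto simp: TT_def)
  also have "\<dots> \<le> (\<Sum>X\<in>TT. card {a \<in> N. \<forall>x\<in>X. R x a})"
    using W by (intro card_UN_le) (auto simp: TT_def)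
  also have "\<dots> \<le> (\<Sum>X\<in>TT. 2)"
    using W K33 by (intro sum_mono) (auto simp: TT_def)
  finally have B: "card B \<le> 20" using cardT by simp
  have "5 * card N = (\<Sum>x\<in>W. card N)" using W by simp
  also have "\<dots> \<le> (\<Sum>x\<in>W. 2 * card {a \<in> N. R x a} + 2)"
    using W dense by (intro sum_mono) auto
  also have "\<dots> = 2 * (\<Sum>x\<in>W. card {a \<in> N. R x a}) + 10"
    unfolding sum.distrib sum_distrib_left using W by simp
  finally have lower: "5 * card N \<le> 2 * (\<Sum>x\<in>W. card {a \<in> N. R x a}) + 10" .
  have "(\<Sum>x\<in>W. card {a \<in> N. R x a}) = (\<Sum>a\<in>N. card {x \<in> W. R x a})"
    using sum.swap_restrict[OF W(3) fin, of "\<lambda>_ _. 1::nat" R] by simp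
  also have "\<dots> \<le> (\<Sum>a\<in>N. 2 + (if a \<in> B then 3 else 0))"
  proof (rule sum_mono)
    fix a assume "a \<in> N"
    moreover have "card {x \<in> W. R x a} \<le> 5"
      using W card_mono[of W "{x \<in> W. R x a}"] by auto
    ultimately show "card {x \<in> W. R x a} \<le> 2 + (if a \<in> B then 3 else 0)"
      by (auto simp: B_def)
  qed
  also have "\<dots> = 2 * card N + 3 * card (N \<inter> B)"
    unfolding sum.distrib using fin by (simp add: sum.If_cases)
  also have "N \<inter> B = B" by (auto simp: B_def)
  finally show ?thesis using B lower by linarith
qed simp

section \<open>Parallel neighbours\<close>

text \<open>The second neighbour of \<open>u\<close> in the polygon \<open>F\<close>; meaningful
  when \<open>F\<close> is a two-face containing the edge from \<open>u\<close> to
  \<open>v\<close>.\<close>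

definition other_nbr :: "'a::euclidean_space set \<Rightarrow> 'a \<Rightarrow> 'a \<Rightarrow> 'a set \<Rightarrow> 'a" where
  "other_nbr P u v F = (THE a. nbrs P u \<inter> F = {v, a} \<and> a \<noteq> v)"

lemma other_nbr:
  fixes P :: "'a::euclidean_space set"
  assumes P: "polytope P" and v: "v \<in> nbrs P u"
    and F: "F \<in> two_faces_containing P (closed_segment u v)"
  shows "nbrs P u \<inter> F = {v, other_nbr P u v F}" "other_nbr P u v F \<noteq> v"
proof -
  have F': "F face_of P" "aff_dim F = 2" "u \<in> F" "v \<in> F"
    using F by (auto simp: two_faces_containing_def)
  have "card (nbrs P u \<inter> F) = 2"
    using card_nbrs_two_face P F' nbrs_extreme v by blast
  then obtain x y where xy: "nbrs P u \<inter> F = {x, y}" "x \<noteq> y"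
    by (auto simp: card_2_iff)
  moreover have "v \<in> nbrs P u \<inter> F" using v F' by blast
  ultimately have "\<exists>a. nbrs P u \<inter> F = {v, a} \<and> a \<noteq> v" by (cases "v = x") auto
  then have "\<exists>!a. nbrs P u \<inter> F = {v, a} \<and> a \<noteq> v" by (auto simp: doubleton_eq_iff)
  from theI'[OF this] show "nbrs P u \<inter> F = {v, other_nbr P u v F}" "other_nbr P u v F \<noteq> v"
    unfolding other_nbr_def by auto
qed

lemma segment_eq_cancel:
  fixes u :: "'a::euclidean_space"
  shows "closed_segment u v = closed_segment u w \<longleftrightarrow> v = w"
  by (auto simp: doubleton_eq_iff)

text \<open>Injective because two edges at \<open>u\<close> determine their two-face, surjective
  because a two-face has only two edges at \<open>u\<close>. The number of two-faces on an edge thus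
  becomes a degree in the vertex figure.\<close>

lemma bij_betw_other_nbr:
  fixes P :: "'a::euclidean_space set"
  assumes P: "polytope P" and v: "v \<in> nbrs P u"
  shows "bij_betw (other_nbr P u v) (two_faces_containing P (closed_segment u v)) {a. linked P u v a}"
proof (rule bij_betw_imageI)
  let ?T = "two_faces_containing P (closed_segment u v)"
  show "inj_on (other_nbr P u v) ?T"
  proof (rule inj_onI)
    fix F G assume FG: "F \<in> ?T" "G \<in> ?T" "other_nbr P u v F = other_nbr P u v G"
    define a where "a = other_nbr P u v F"
    have a: "a \<in> nbrs P u" "a \<in> F" "a \<in> G" "a \<noteq> v"
      using other_nbr[OF P v FG(1)] other_nbr[OF P v FG(2)] FG(3) unfolding a_def by auto
    have "closed_segment u a \<subseteq> F" "closed_segment u a \<subseteq> G"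
      using segment_subset_face[of _ P u a] FG a unfolding two_faces_containing_def by auto
    then show "F = G"
      using two_face_unique[OF P, of F G "closed_segment u v" "closed_segment u a"] FG a v
      by (auto simp: two_faces_containing_def nbrs_def segment_eq_cancel)
  qed
  show "other_nbr P u v ` ?T = {a. linked P u v a}"
  proof safe
    fix F assume F: "F \<in> ?T"
    then have "F face_of P" "aff_dim F = 2" "u \<in> F" "v \<in> F"
      by (auto simp: two_faces_containing_def)
    moreover have "other_nbr P u v F \<in> nbrs P u" "other_nbr P u v F \<in> F"
      using other_nbr(1)[OF P v F] by auto
    ultimately show "linked P u v (other_nbr P u v F)"
      using other_nbr(2)[OF P v F] v by (auto simp: linked_def)
  next
    fix a assume "linked P u v a"
    then obtain F where F: "F face_of P" "aff_dim F = 2" "u \<in> F" "v \<in> F" "a \<in> F" 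
      and a: "a \<in> nbrs P u" "a \<noteq> v"
      unfolding linked_def by metis
    then have FT: "F \<in> ?T" by (simp add: two_faces_containing_def segment_subset_face)
    have "a \<in> {v, other_nbr P u v F}"
      using other_nbr(1)[OF P v FT] a F by auto
    then show "a \<in> other_nbr P u v ` ?T" using a FT by auto
  qed
qed

text \<open>For an edge from \<open>u\<close> to \<open>v\<close>, these points index its parallel
  neighbours of the first kind at the end \<open>u\<close>.\<close>

definition unlinked :: "'a::euclidean_space set \<Rightarrow> 'a \<Rightarrow> 'a \<Rightarrow> 'a set" where
  "unlinked P u v = {a \<in> nbrs P u. a \<noteq> v \<and> \<not> linked P u v a}"

text \<open>For a two-face \<open>F\<close> containing \<open>e\<close>, the parallel neighbours of
  the second kind lying in \<open>F\<close>.\<close>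

definition opposite_edges :: "'a::euclidean_space set \<Rightarrow> 'a set \<Rightarrow> 'a set \<Rightarrow> 'a set set" where
  "opposite_edges P e F = {e'. e' edge_of P \<and> e' \<subseteq> F \<and> \<not> share_vertex P e e'}"

lemma finite_two_faces_containing: "polytope P \<Longrightarrow> finite (two_faces_containing P e)"
  unfolding two_faces_containing_def by (rule finite_subset[OF _ finite_polytope_faces]) auto

lemma finite_edges: "polytope P \<Longrightarrow> finite {e. e edge_of P}"
  by (rule finite_subset[OF _ finite_polytope_faces]) (auto simp: edge_of_def)

lemma nbrs_decomp:
  assumes "polytope P" "v \<in> nbrs P u"
  shows "nbrs P u = insert v ({a. linked P u v a} \<union> unlinked P u v)"
    "v \<notin> {a. linked P u v a} \<union> unlinked P u v" "{a. linked P u v a} \<inter> unlinked P u v = {}"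
    "finite {a. linked P u v a}" "finite (unlinked P u v)"
proof -
  show *: "nbrs P u = insert v ({a. linked P u v a} \<union> unlinked P u v)"
    using assms by (auto simp: unlinked_def linked_def)
  show "finite {a. linked P u v a}" "finite (unlinked P u v)"
    using finite_nbrs[OF assms(1), of u] unfolding * by auto
qed (auto simp: unlinked_def linked_def)

lemma card_nbrs_decomp:
  fixes P :: "'a::euclidean_space set"
  assumes "polytope P" "v \<in> nbrs P u"
  shows "card (nbrs P u) =
    1 + card (two_faces_containing P (closed_segment u v)) + card (unlinked P u v)"
proof -
  have "card {a. linked P u v a} = card (two_faces_containing P (closed_segment u v))"
    using bij_betw_same_card[OF bij_betw_other_nbr[OF assms]] by simp
  then show ?thesis
    unfolding nbrs_decomp(1)[OF assms] using nbrs_decomp(2-)[OF assms]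
    by (simp add: card_Un_disjoint)
qed

lemma share_vertex_edge:
  assumes "v \<in> nbrs P u"
  shows "share_vertex P (closed_segment u v) e' \<longleftrightarrow> u \<in> e' \<or> v \<in> e'"
proof -
  have "closed_segment u v edge_of P" using assms by (simp add: nbrs_def)
  then show ?thesis
    unfolding share_vertex_def using extreme_point_of_edge[of u v P] by metis
qed

lemma segment_unlinked_parallel:
  fixes P :: "'a::euclidean_space set"
  assumes "v \<in> nbrs P u" "a \<in> unlinked P u v"
  shows "closed_segment u a \<in> parallel_neighbors P (closed_segment u v)"
proof -
  have a: "a \<in> nbrs P u" "a \<noteq> v" "\<not> linked P u v a" using assms by (auto simp: unlinked_def)
  have "\<not> in_common_two_face P (closed_segment u v) (closed_segment u a)"
  proof
    assume "in_common_two_face P (closed_segment u v) (closed_segment u a)"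
    then obtain F where F: "F face_of P" "aff_dim F = 2"
      "closed_segment u v \<subseteq> F" "closed_segment u a \<subseteq> F"
      unfolding in_common_two_face_def by blast
    then have "u \<in> F" "v \<in> F" "a \<in> F" by auto
    then have "linked P u v a" unfolding linked_def using F(1,2) a(1,2) assms(1) by metis
    then show False using a by blast
  qed
  then show ?thesis
    using a share_vertex_edge[OF assms(1)]
    by (auto simp: parallel_neighbors_def nbrs_def segment_eq_cancel)
qed

text \<open>The families counted on the left consist of parallel neighbours and are disjoint: those
  at \<open>u\<close> and at \<open>v\<close> meet the edge at different ends, while opposite edges
  avoid both ends.\<close>

lemma card_parallel_neighbors_ge:
  fixes P :: "'a::euclidean_space set"
  assumes P: "polytope P" and v: "v \<in> nbrs P u"
  defines "e \<equiv> closed_segment u v"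
  shows "card (unlinked P u v) + card (unlinked P v u)
      + (\<Sum>F\<in>two_faces_containing P e. card (opposite_edges P e F)) \<le> card (parallel_neighbors P e)"
proof -
  have u: "u \<in> nbrs P v" using v nbrs_sym by blast
  have ee: "e edge_of P" using v by (simp add: e_def nbrs_def)
  define A where "A = closed_segment u ` unlinked P u v"
  define B where "B = closed_segment v ` unlinked P v u"
  define C where "C = (\<Union>F\<in>two_faces_containing P e. opposite_edges P e F)"
  have fin: "finite (two_faces_containing P e)" "finite (opposite_edges P e F)" 
    "finite (parallel_neighbors P e)" "finite A" "finite B" "finite C" for F
  proof -
    show "finite (two_faces_containing P e)" using finite_two_faces_containing P by blast
    moreover show *: "finite (opposite_edges P e F)" for F
      unfolding opposite_edges_def by (rule finite_subset[OF _ finite_edges[OF P]]) auto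
    ultimately show "finite C" by (simp add: C_def)
    show "finite (parallel_neighbors P e)"
      unfolding parallel_neighbors_def by (rule finite_subset[OF _ finite_edges[OF P]]) auto
    show "finite A" "finite B" using nbrs_decomp(5)[OF P v] nbrs_decomp(5)[OF P u] by (simp_all add: A_def B_def)
  qed
  have sh: "share_vertex P e e' \<longleftrightarrow> u \<in> e' \<or> v \<in> e'" for e'
    using share_vertex_edge[OF v] by (simp add: e_def)
  have cC: "card C = (\<Sum>F\<in>two_faces_containing P e. card (opposite_edges P e F))"
    unfolding C_def
  proof (rule card_UN_disjoint)
    show "\<forall>F\<in>two_faces_containing P e. \<forall>G\<in>two_faces_containing P e.
        F \<noteq> G \<longrightarrow> opposite_edges P e F \<inter> opposite_edges P e G = {}"
    \<comment> \<open>A common opposite edge would put two distinct edges into both two-faces,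
      forcing \<open>F = G\<close>.\<close>
    proof (intro ballI impI, rule ccontr)
      fix F G assume FG: "F \<in> two_faces_containing P e" "G \<in> two_faces_containing P e" "F \<noteq> G"
        "opposite_edges P e F \<inter> opposite_edges P e G \<noteq> {}"
      then obtain e' where e': "e' edge_of P" "e' \<subseteq> F" "e' \<subseteq> G" "\<not> share_vertex P e e'"
        by (auto simp: opposite_edges_def)
      then have "e \<noteq> e'" using sh by (auto simp: e_def)
      then show False
        using two_face_unique[OF P _ _ _ _ ee e'(1), of F G] FG e'
        by (auto simp: two_faces_containing_def)
    qed
  qed (use fin in auto)
  have cA: "card A = card (unlinked P u v)" "card B = card (unlinked P v u)"
    unfolding A_def B_def
    by (intro card_image inj_onI; simp only: segment_eq_cancel)+
  have "A \<inter> B = {}"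
  proof (rule ccontr)
    assume "A \<inter> B \<noteq> {}"
    then obtain a b where "a \<in> unlinked P u v" "b \<in> unlinked P v u"
      "closed_segment u a = closed_segment v b" unfolding A_def B_def by blast
    then show False using v by (auto simp: unlinked_def doubleton_eq_iff)
  qed
  moreover have "(A \<union> B) \<inter> C = {}"
  proof -
    have "share_vertex P e e'" if "e' \<in> A \<union> B" for e'
      using that sh unfolding A_def B_def by auto
    moreover have "\<not> share_vertex P e e'" if "e' \<in> C" for e'
      using that unfolding C_def opposite_edges_def by blast
    ultimately show ?thesis by blast
  qed
  ultimately have "card (A \<union> B \<union> C) = card A + card B + card C"
    using fin by (simp add: card_Un_disjoint)
  moreover have "A \<union> B \<union> C \<subseteq> parallel_neighbors P e"
  proof -
    have "A \<subseteq> parallel_neighbors P e"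
      using segment_unlinked_parallel[OF v] by (auto simp: A_def e_def)
    moreover have "B \<subseteq> parallel_neighbors P e"
      using segment_unlinked_parallel[OF u] by (auto simp: B_def e_def closed_segment_commute)
    moreover have "C \<subseteq> parallel_neighbors P e"
    proof
      fix e' assume "e' \<in> C"
      then obtain F where F: "F face_of P" "aff_dim F = 2" "e \<subseteq> F" "e' edge_of P" "e' \<subseteq> F"
        "\<not> share_vertex P e e'"
        unfolding C_def opposite_edges_def two_faces_containing_def by blast
      then have "in_common_two_face P e e'" unfolding in_common_two_face_def by blast
      moreover have "e' \<noteq> e" using F(6) sh by (auto simp: e_def)
      ultimately show "e' \<in> parallel_neighbors P e"
        using F by (simp add: parallel_neighbors_def)
    qed
    ultimately show ?thesis by blast
  qed
  ultimately show ?thesis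
    using card_mono[OF fin(3)] cA cC by metis
qed

lemma card_nbrs_bound:
  fixes P :: "'a::euclidean_space set"
  assumes P: "polytope P" and dim: "aff_dim P \<le> 4" and pos: "forman_ricci_positive P"
  shows "card (nbrs P u) \<le> 130"
proof (rule K33_free_dense_card_bound[where R = "linked P u"])
  show "finite (nbrs P u)" using P finite_nbrs by blast
  have eq: "{a \<in> nbrs P u. linked P u x a} = {a. linked P u x a}" for x
    by (auto simp: linked_def)
  fix v assume v: "v \<in> nbrs P u"
  define e where "e = closed_segment u v"
  have u: "u \<in> nbrs P v" using v nbrs_sym by blast
  have "forman_ricci P e > 0"
    using pos v by (auto simp: forman_ricci_positive_def nbrs_def e_def)
  \<comment> \<open>Positivity over the integers leaves at most one more parallel neighbour than
    two-faces; the opposite edges are discarded from the count.\<close>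
  then have "card (unlinked P u v) + card (unlinked P v u) \<le> card (two_faces_containing P e) + 1"
    using card_parallel_neighbors_ge[OF P v] unfolding forman_ricci_def e_def by linarith
  moreover have "card {a. linked P u v a} = card (two_faces_containing P e)"
    using bij_betw_same_card[OF bij_betw_other_nbr[OF P v]] by (simp add: e_def)
  ultimately show "card (nbrs P u) \<le> 2 * card {a \<in> nbrs P u. linked P u v a} + 2"
    unfolding eq using card_nbrs_decomp[OF P v] by (simp add: e_def)
next
  fix X assume X: "X \<subseteq> nbrs P u" "card X = 3"
  have "{a \<in> nbrs P u. \<forall>x\<in>X. linked P u x a} = {a. \<forall>x\<in>X. linked P u x a}"
  proof -
    obtain x where "x \<in> X" using X(2) by fastforce
    then show ?thesis unfolding linked_def by blast
  qed
  then show "card {a \<in> nbrs P u. \<forall>x\<in>X. linked P u x a} \<le> 2"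
    using card_common_linked_le_2[OF P dim X(2)] by simp
qed

section \<open>Lipschitz functions and curvature\<close>

text \<open>The walk of the simplex method: while the maximum is not reached, some neighbour
  improves \<open>k\<close>, and the set of strictly better vertices shrinks at each step.\<close>

lemma improving_path:
  fixes F :: "'a::euclidean_space set"
  assumes F: "polytope F" and w: "w extreme_point_of F"
  shows "\<exists>t. t extreme_point_of F \<and> (w, t) \<in> {(x, y). y \<in> nbrs F x \<and> k \<bullet> x < k \<bullet> y}\<^sup>* \<and>
    (\<forall>y\<in>F. k \<bullet> y \<le> k \<bullet> t)"
  using w
proof (induction "card {x. x extreme_point_of F \<and> k \<bullet> w < k \<bullet> x}" arbitrary: w rule: less_induct)
  case less
  let ?R = "{(x, y). y \<in> nbrs F x \<and> k \<bullet> x < k \<bullet> y}"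
  show ?case
  proof (cases "\<forall>y\<in>F. k \<bullet> y \<le> k \<bullet> w")
    case True
    then show ?thesis using less.prems by blast
  next
    case False
    then obtain y where "y \<in> F" "k \<bullet> w < k \<bullet> y" by force
    then obtain w' where w': "w' \<in> nbrs F w" "k \<bullet> w < k \<bullet> w'"
      using improving_neighbour[OF F less.prems] by metis
    have e: "w' extreme_point_of F" using nbrs_extreme(1)[OF w'(1)] .
    have "{x. x extreme_point_of F \<and> k \<bullet> w' < k \<bullet> x} \<subset> {x. x extreme_point_of F \<and> k \<bullet> w < k \<bullet> x}"
      using w' e by force
    then have "card {x. x extreme_point_of F \<and> k \<bullet> w' < k \<bullet> x} < card {x. x extreme_point_of F \<and> k \<bullet> w < k \<bullet> x}"
      using polytope_finite_extreme_points[OF F] by (intro psubset_card_mono) auto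
    from less.hyps[OF this e] obtain t where t: "t extreme_point_of F" "(w', t) \<in> ?R\<^sup>*"
      "\<forall>y\<in>F. k \<bullet> y \<le> k \<bullet> t" by blast
    moreover have "(w, w') \<in> ?R" using w' by simp
    ultimately have "(w, t) \<in> ?R\<^sup>*" by (meson converse_rtrancl_into_rtrancl)
    then show ?thesis using t by blast
  qed
qed

text \<open>A discrete intermediate value argument along the path.\<close>

lemma rtrancl_crossing:
  fixes g :: "'a \<Rightarrow> int"
  assumes "(b, a) \<in> R\<^sup>*" "g b \<le> k" "k < g a"
  obtains x y where "(x, y) \<in> R" "g x \<le> k" "k < g y"
  using assms
proof (induction arbitrary: thesis rule: rtrancl_induct)
  case base
  then show ?case by simp
next
  case (step y z)
  then show ?case by (cases "k < g y") auto
qed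

text \<open>Every integer level between \<open>g b\<close> and \<open>g a\<close> is crossed by an edge of its own.\<close>

lemma lipschitz_diff_le_card_edges:
  fixes g :: "'a::euclidean_space \<Rightarrow> int"
  assumes ba: "(b, a) \<in> R\<^sup>*" and S: "finite S" 
    and R: "\<And>x y. (x, y) \<in> R \<Longrightarrow> closed_segment x y \<in> S \<and> \<bar>g x - g y\<bar> \<le> 1"
  shows "g a - g b \<le> int (card S)"
proof -
  have "\<exists>x y. (x, y) \<in> R \<and> g x \<le> k \<and> k < g y" if "k \<in> {g b..<g a}" for k
    using rtrancl_crossing[OF ba, of g k] that by (metis atLeastLessThan_iff)
  then obtain X Y where XY: "\<And>k. k \<in> {g b..<g a} \<Longrightarrow> (X k, Y k) \<in> R \<and> g (X k) \<le> k \<and> k < g (Y k)"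
    by metis
  \<comment> \<open>A step of size at most 1 that crosses above \<open>k\<close> goes exactly from
    \<open>k\<close> to \<open>k + 1\<close>.\<close>
  then have lev: "g (X k) = k \<and> g (Y k) = k + 1" if "k \<in> {g b..<g a}" for k
    using R[of "X k" "Y k"] XY[OF that] by auto
  have "inj_on (\<lambda>k. closed_segment (X k) (Y k)) {g b..<g a}"
  proof (rule inj_onI)
    fix k j assume kj: "k \<in> {g b..<g a}" "j \<in> {g b..<g a}"
      "closed_segment (X k) (Y k) = closed_segment (X j) (Y j)"
    \<comment> \<open>Equal segments may have their ends swapped, but then \<open>k = j + 1\<close>
      and \<open>k + 1 = j\<close>, which is absurd.\<close>
    have "g (X k) = g (X j) \<or> g (X k) = g (Y j) \<and> g (Y k) = g (X j)"
      using kj(3) unfolding closed_segment_eq doubleton_eq_iff by metis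
    then show "k = j" using lev[OF kj(1)] lev[OF kj(2)] by linarith
  qed
  moreover have "(\<lambda>k. closed_segment (X k) (Y k)) ` {g b..<g a} \<subseteq> S"
  proof (rule image_subsetI)
    fix k assume "k \<in> {g b..<g a}"
    then show "closed_segment (X k) (Y k) \<in> S" using R[of "X k" "Y k"] XY[of k] by simp
  qed
  ultimately have "card {g b..<g a} \<le> card S"
    using card_inj_on_le S by blast
  then show ?thesis by simp
qed

text \<open>Both vertices climb, away from the edge \<open>e\<close>, to the top face of the polygon, which is a
  vertex or an edge.\<close>

lemma polygon_connected_off_edge:
  fixes P :: "'a::euclidean_space set"
  assumes P: "polytope P" and F: "F face_of P" "aff_dim F = 2"
    and v: "v \<in> nbrs P u" "closed_segment u v \<subseteq> F"
    and a: "a extreme_point_of P" "a \<in> F" "a \<notin> {u, v}"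
    and b: "b extreme_point_of P" "b \<in> F" "b \<notin> {u, v}"
  defines "R \<equiv> {(x, y). y \<in> nbrs P x \<and> x \<in> F \<and> y \<in> F \<and> x \<notin> {u, v} \<and> y \<notin> {u, v}}"
  shows "(b, a) \<in> R\<^sup>*"
proof -
  have poly: "polytope F" using F P face_of_polytope_polytope by blast
  have uv: "u \<in> F" "v \<in> F" using v by auto
  have "closed_segment u v face_of F"
    using v F face_of_face[OF F(1)] by (auto simp: nbrs_def edge_of_def)
  then obtain h c where h: "\<And>x. x \<in> F \<Longrightarrow> h \<bullet> x \<le> c" "closed_segment u v = F \<inter> {x. h \<bullet> x = c}"
    using polytope_face_exposed[OF poly] by metis
  \<comment> \<open>On \<open>F\<close>, \<open>k\<close> attains its minimum \<open>- c\<close>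
    exactly along the edge from \<open>u\<close> to \<open>v\<close>, so a climbing path starting at
    another vertex never meets that edge.\<close>
  define k where "k = - h"
  have ku: "k \<bullet> u = - c" "k \<bullet> v = - c" using h(2) by (auto simp: k_def)
  have off: "- c < k \<bullet> x" if "x extreme_point_of F" "x \<notin> {u, v}" for x
  proof -
    have xF: "x \<in> F" and xP: "x extreme_point_of P"
      using that extreme_point_of_face[OF F(1)] by auto
    have "x \<notin> closed_segment u v" using extreme_point_of_edge[of u v P x] v(1) xP that 
      unfolding nbrs_def by simp
    then have "h \<bullet> x \<noteq> c" using h(2) xF by auto
    then show ?thesis using h(1)[OF xF] by (simp add: k_def)
  qed
  have symR: "sym (R\<^sup>*)" by (intro sym_rtrancl) (auto simp: sym_def R_def nbrs_sym)
  have reach: "\<exists>t. t extreme_point_of F \<and> t \<notin> {u, v} \<and> (w, t) \<in> R\<^sup>* \<and> (\<forall>y\<in>F. k \<bullet> y \<le> k \<bullet> t)"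
    if w: "w extreme_point_of F" "w \<notin> {u, v}" for w
  proof -
    obtain t where t: "t extreme_point_of F" "(w, t) \<in> {(x, y). y \<in> nbrs F x \<and> k \<bullet> x < k \<bullet> y}\<^sup>*"
      "\<forall>y\<in>F. k \<bullet> y \<le> k \<bullet> t" using improving_path[OF poly w(1)] by blast
    from t(2) have "(w, t) \<in> R\<^sup>* \<and> - c < k \<bullet> t"
    proof (induction rule: rtrancl_induct)
      case base
      then show ?case using off[OF w] by simp
    next
      case (step y z)
      then have yz: "z \<in> nbrs F y" "- c < k \<bullet> y" "- c < k \<bullet> z" by auto
      have "y \<in> F" "z \<in> F" using nbrs_in[OF yz(1)] by auto
      moreover have "z \<in> nbrs P y" using yz nbrs_face[OF F(1) \<open>y \<in> F\<close>] by blast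
      moreover have "y \<notin> {u, v}" "z \<notin> {u, v}" using ku yz by auto
      ultimately have "(y, z) \<in> R" by (simp add: R_def)
      then show ?case using step yz by (meson rtrancl_into_rtrancl)
    qed
    moreover from this have "t \<notin> {u, v}" using ku by auto
    ultimately show ?thesis using t by blast
  qed
  have ext: "a extreme_point_of F" "b extreme_point_of F"
    using a b extreme_point_of_face[OF F(1)] by auto
  obtain s where s: "s extreme_point_of F" "s \<notin> {u, v}" "(a, s) \<in> R\<^sup>*" "\<forall>y\<in>F. k \<bullet> y \<le> k \<bullet> s"
    using reach[OF ext(1) a(3)] by blast
  obtain t where t: "t extreme_point_of F" "t \<notin> {u, v}" "(b, t) \<in> R\<^sup>*" "\<forall>y\<in>F. k \<bullet> y \<le> k \<bullet> t"
    using reach[OF ext(2) b(3)] by blast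
  have stF: "s \<in> F" "t \<in> F" using s t by (auto simp: extreme_point_of_def)
  have kst: "k \<bullet> s = k \<bullet> t" using s(4) t(4) stF by (meson antisym)
  \<comment> \<open>Two distinct top vertices span a top face of dimension at least 1. It misses
    \<open>u\<close>, so it is proper and hence an edge joining them.\<close>
  have "(t, s) \<in> R\<^sup>*"
  proof (cases "s = t")
    case False
    define T where "T = F \<inter> {x. k \<bullet> x = k \<bullet> t}"
    have T: "T face_of F"
      unfolding T_def using t(4) F face_of_imp_convex by (intro face_of_Int_supporting_hyperplane_le) auto
    have "u \<notin> T" using off[OF t(1,2)] ku by (auto simp: T_def)
    then have "T \<noteq> F" using uv by blast
    then have "aff_dim T < 2"
      using face_of_aff_dim_lt[OF _ T] F face_of_imp_convex by metis
    moreover have "aff_dim {s, t} \<le> aff_dim T"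
      using stF kst by (intro aff_dim_subset) (auto simp: T_def)
    ultimately have "T edge_of F" using False T by (simp add: edge_of_def)
    moreover have "t \<in> T" "s \<in> T" using stF kst by (auto simp: T_def)
    ultimately obtain w where w: "w \<in> nbrs F t" "T = closed_segment t w"
      using edge_at_vertex[OF poly] t(1) by metis
    then have "s = w" using extreme_point_of_edge[of t w F s] s(1) \<open>s \<in> T\<close> False
      unfolding nbrs_def by auto
    then have "s \<in> nbrs P t" using w nbrs_face[OF F(1) stF(2)] by auto
    then have "(t, s) \<in> R" using stF s t by (simp add: R_def)
    then show ?thesis by blast
  qed simp
  moreover have "(s, a) \<in> R\<^sup>*" using s(3) symR by (meson symD)
  ultimately show ?thesis using t(3) by (meson rtrancl_trans)
qed

text \<open>Going round the polygon from one remaining neighbour to the other while avoiding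
  \<open>u\<close> and \<open>v\<close> uses opposite edges only, each changing \<open>g\<close> by
  at most 1. In a triangle both neighbours coincide and there is no opposite edge.\<close>

lemma lipschitz_across_two_face:
  fixes P :: "'a::euclidean_space set" and g :: "'a \<Rightarrow> int"
  assumes P: "polytope P" and v: "v \<in> nbrs P u"
    and F: "F \<in> two_faces_containing P (closed_segment u v)"
    and lip: "\<And>x y. y \<in> nbrs P x \<Longrightarrow> \<bar>g x - g y\<bar> \<le> 1"
  shows "g (other_nbr P v u F) - g (other_nbr P u v F) \<le> 
    int (card (opposite_edges P (closed_segment u v) F))"
proof -
  have F': "F face_of P" "aff_dim F = 2" "closed_segment u v \<subseteq> F"
    using F by (auto simp: two_faces_containing_def)
  have u: "u \<in> nbrs P v" using v nbrs_sym by blast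
  have Fv: "F \<in> two_faces_containing P (closed_segment v u)"
    using F by (simp add: closed_segment_commute)
  define a where "a = other_nbr P u v F"
  define b where "b = other_nbr P v u F"
  have a: "a \<in> nbrs P u" "a \<in> F" "a \<notin> {u, v}"
    using other_nbr[OF P v F] nbrs_irrefl[of u P] unfolding a_def by auto
  have b: "b \<in> nbrs P v" "b \<in> F" "b \<notin> {u, v}"
    using other_nbr[OF P u Fv] nbrs_irrefl[of v P] unfolding b_def by auto
  define R where "R = {(x, y). y \<in> nbrs P x \<and> x \<in> F \<and> y \<in> F \<and> x \<notin> {u, v} \<and> y \<notin> {u, v}}"
  have path: "(a, b) \<in> R\<^sup>*"
    unfolding R_def
    by (rule polygon_connected_off_edge[OF P F'(1,2) v F'(3) nbrs_extreme(1)[OF b(1)] b(2,3)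
          nbrs_extreme(1)[OF a(1)] a(2,3)])
  have edges: "closed_segment x y \<in> opposite_edges P (closed_segment u v) F \<and> \<bar>g x - g y\<bar> \<le> 1"
    if "(x, y) \<in> R" for x y
  proof -
    have xy: "y \<in> nbrs P x" "x \<in> F" "y \<in> F" "x \<notin> {u, v}" "y \<notin> {u, v}"
      using that by (auto simp: R_def)
    have e: "closed_segment x y edge_of P" using xy by (simp add: nbrs_def)
    have "u \<notin> closed_segment x y" "v \<notin> closed_segment x y"
      using extreme_point_of_edge[OF e, of u] extreme_point_of_edge[OF e, of v]
        nbrs_extreme[OF v] xy by auto
    then have "\<not> share_vertex P (closed_segment u v) (closed_segment x y)"
      using share_vertex_edge[OF v] by blast
    then show ?thesis
      using e segment_subset_face[OF F'(1) xy(2,3)] lip[OF xy(1)] by (simp add: opposite_edges_def)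
  qed
  have "finite (opposite_edges P (closed_segment u v) F)"
    unfolding opposite_edges_def by (rule finite_subset[OF _ finite_edges[OF P]]) auto
  from lipschitz_diff_le_card_edges[OF path this edges] show ?thesis
    unfolding a_def b_def .
qed

text \<open>The unnormalised graph Laplacian of \<open>g\<close> at \<open>u\<close>.\<close>

definition drift :: "'a::euclidean_space set \<Rightarrow> ('a \<Rightarrow> int) \<Rightarrow> 'a \<Rightarrow> int" where
  "drift P g u = (\<Sum>w\<in>nbrs P u. g w - g u)"

text \<open>Indexing the linked neighbours by two-faces allows the sums at both ends of an edge to
  be compared face by face.\<close>

lemma drift_decomp:
  fixes P :: "'a::euclidean_space set"
  assumes P: "polytope P" and v: "v \<in> nbrs P u"
  shows "drift P g u = g v - g u +
    (\<Sum>F\<in>two_faces_containing P (closed_segment u v). g (other_nbr P u v F) - g u) +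
    (\<Sum>a\<in>unlinked P u v. g a - g u)"
proof -
  have "drift P g u = (\<Sum>w\<in>insert v ({a. linked P u v a} \<union> unlinked P u v). g w - g u)"
    unfolding drift_def using nbrs_decomp(1)[OF assms] by simp
  also have "\<dots> = g v - g u + ((\<Sum>a\<in>{a. linked P u v a}. g a - g u) + (\<Sum>a\<in>unlinked P u v. g a - g u))"
    using nbrs_decomp(2-)[OF assms] by (simp add: sum.union_disjoint del: mem_Collect_eq)
  also have "(\<Sum>a\<in>{a. linked P u v a}. g a - g u) =
      (\<Sum>F\<in>two_faces_containing P (closed_segment u v). g (other_nbr P u v F) - g u)"
    using sum.reindex_bij_betw[OF bij_betw_other_nbr[OF assms], of "\<lambda>a. g a - g u"] by simp
  finally show ?thesis by simp
qed

text \<open>Discrete counterpart of Bochner's formula: where a 1-Lipschitz function has maximal slope,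
  its Laplacian drops by at least the Forman--Ricci curvature.\<close>

lemma drift_diff_ge_forman_ricci:
  fixes P :: "'a::euclidean_space set" and g :: "'a \<Rightarrow> int"
  assumes P: "polytope P" and v: "v \<in> nbrs P u" and guv: "g v = g u + 1"
    and lip: "\<And>x y. y \<in> nbrs P x \<Longrightarrow> \<bar>g x - g y\<bar> \<le> 1"
  shows "forman_ricci P (closed_segment u v) \<le> drift P g u - drift P g v"
proof -
  define e where "e = closed_segment u v"
  let ?T = "two_faces_containing P e"
  have u: "u \<in> nbrs P v" using v nbrs_sym by blast
  \<comment> \<open>The terms 1 and - 1 that the ends of the edge contribute to each other's drift
    yield the summand 2 of the curvature.\<close>
  have du: "drift P g u = 1 + (\<Sum>F\<in>?T. g (other_nbr P u v F) - g u) + (\<Sum>a\<in>unlinked P u v. g a - g u)"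
    using drift_decomp[OF P v, of g] guv by (simp add: e_def)
  have dv: "drift P g v = - 1 + (\<Sum>F\<in>?T. g (other_nbr P v u F) - g v) + (\<Sum>a\<in>unlinked P v u. g a - g v)"
    using drift_decomp[OF P u, of g] guv by (simp add: e_def closed_segment_commute)
  have "(\<Sum>a\<in>unlinked P u v. -1) \<le> (\<Sum>a\<in>unlinked P u v. g a - g u)"
    using lip by (intro sum_mono) (force simp: unlinked_def)
  then have U: "- int (card (unlinked P u v)) \<le> (\<Sum>a\<in>unlinked P u v. g a - g u)" by simp
  have "(\<Sum>a\<in>unlinked P v u. g a - g v) \<le> (\<Sum>a\<in>unlinked P v u. 1)"
    using lip by (intro sum_mono) (force simp: unlinked_def)
  then have V: "(\<Sum>a\<in>unlinked P v u. g a - g v) \<le> int (card (unlinked P v u))" by simp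
  \<comment> \<open>Since \<open>g v - g u = 1\<close>, each two-face contributes 1 minus the
    increase of \<open>g\<close> across it, and the opposite edges bound that increase.\<close>
  have "(\<Sum>F\<in>?T. 1 - int (card (opposite_edges P e F))) \<le>
      (\<Sum>F\<in>?T. (g (other_nbr P u v F) - g u) - (g (other_nbr P v u F) - g v))"
  proof (rule sum_mono)
    fix F assume "F \<in> ?T"
    then show "1 - int (card (opposite_edges P e F)) \<le>
        (g (other_nbr P u v F) - g u) - (g (other_nbr P v u F) - g v)"
      using lipschitz_across_two_face[where g = g, OF P v _ lip] guv unfolding e_def by fastforce
  qed
  then have "int (card ?T) - (\<Sum>F\<in>?T. int (card (opposite_edges P e F))) \<le>
      (\<Sum>F\<in>?T. g (other_nbr P u v F) - g u) - (\<Sum>F\<in>?T. g (other_nbr P v u F) - g v)"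
    by (simp add: sum_subtractf)
  moreover have "int (card (unlinked P u v)) + int (card (unlinked P v u))
      + (\<Sum>F\<in>?T. int (card (opposite_edges P e F))) \<le> int (card (parallel_neighbors P e))"
    using card_parallel_neighbors_ge[OF P v] unfolding e_def[symmetric]
    by (simp flip: of_nat_add of_nat_sum)
  ultimately show ?thesis
    using U V du dv unfolding forman_ricci_def e_def[symmetric] by linarith
qed

section \<open>Diameter and number of vertices\<close>

definition graph_rel :: "'a::euclidean_space set \<Rightarrow> ('a \<times> 'a) set" where
  "graph_rel P = {(x, y). y \<in> nbrs P x}"

text \<open>\<open>LEAST\<close> is meaningful between vertices, where
  \<open>graph_connected\<close> provides a walk.\<close>

definition graph_dist :: "'a::euclidean_space set \<Rightarrow> 'a \<Rightarrow> 'a \<Rightarrow> nat" where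
  "graph_dist P u v = (LEAST n. (u, v) \<in> graph_rel P ^^ n)"

text \<open>Choose a functional whose maximum on \<open>P\<close> is attained at \<open>u\<close>
  only. Climbing from \<open>w\<close> ends at \<open>u\<close>, and the walk can be
  reversed.\<close>

lemma graph_connected:
  fixes P :: "'a::euclidean_space set"
  assumes P: "polytope P" and u: "u extreme_point_of P" and w: "w extreme_point_of P"
  shows "(u, w) \<in> (graph_rel P)\<^sup>*"
proof -
  obtain a b where ab: "\<And>x. x \<in> P \<Longrightarrow> a \<bullet> x \<le> b" "{u} = P \<inter> {x. a \<bullet> x = b}"
    using polytope_face_exposed[OF P, of "{u}"] u face_of_singleton by metis
  obtain t where t: "t extreme_point_of P" "(w, t) \<in> {(x, y). y \<in> nbrs P x \<and> a \<bullet> x < a \<bullet> y}\<^sup>*"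
      "\<forall>y\<in>P. a \<bullet> y \<le> a \<bullet> t"
    using improving_path[OF P w] by blast
  have uP: "u \<in> P" "a \<bullet> u = b" using ab by auto
  have tP: "t \<in> P" using t by (simp add: extreme_point_of_def)
  have "a \<bullet> t = b" using ab(1)[OF tP] t(3) uP by (metis antisym)
  then have "t = u" using ab(2) tP by blast
  moreover have "(w, t) \<in> (graph_rel P)\<^sup>*"
    by (rule subsetD[OF rtrancl_mono t(2)]) (auto simp: graph_rel_def)
  moreover have "sym ((graph_rel P)\<^sup>*)"
    by (intro sym_rtrancl) (auto simp: sym_def graph_rel_def nbrs_sym)
  ultimately show ?thesis by (meson symD)
qed

lemma graph_dist_path:
  fixes P :: "'a::euclidean_space set"
  assumes "polytope P" "u extreme_point_of P" "w extreme_point_of P"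
  shows "(u, w) \<in> graph_rel P ^^ graph_dist P u w"
proof -
  obtain n where "(u, w) \<in> graph_rel P ^^ n"
    using graph_connected[OF assms] rtrancl_imp_relpow by metis
  then show ?thesis unfolding graph_dist_def by (rule LeastI)
qed

lemma graph_dist_le: "(u, w) \<in> graph_rel P ^^ n \<Longrightarrow> graph_dist P u w \<le> n"
  unfolding graph_dist_def by (rule Least_le)

lemma graph_dist_Suc_le:
  fixes P :: "'a::euclidean_space set"
  assumes "polytope P" "u extreme_point_of P" "y \<in> nbrs P x"
  shows "graph_dist P u y \<le> Suc (graph_dist P u x)"
proof (rule graph_dist_le)
  have "(u, x) \<in> graph_rel P ^^ graph_dist P u x"
    using graph_dist_path assms nbrs_extreme(2) by blast
  moreover have "(x, y) \<in> graph_rel P" using assms by (simp add: graph_rel_def)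
  ultimately show "(u, y) \<in> graph_rel P ^^ Suc (graph_dist P u x)" by auto
qed

text \<open>Induction along a geodesic: at \<open>u\<close> every term is at most 1, and each step
  lowers the drift by at least the curvature of its edge, a positive integer.\<close>

lemma drift_graph_dist_le:
  fixes P :: "'a::euclidean_space set"
  assumes P: "polytope P" and pos: "forman_ricci_positive P" and u: "u extreme_point_of P"
    and w: "w extreme_point_of P"
  defines "g \<equiv> \<lambda>x. int (graph_dist P u x)"
  shows "drift P g w \<le> int (card (nbrs P u)) - g w"
  using w
proof (induction "graph_dist P u w" arbitrary: w)
  case 0
  then have "w = u" using graph_dist_path[OF P u] by fastforce
  moreover have "graph_dist P u u = 0" using graph_dist_le[where n = 0 and u = u and w = u and P = P] by simp
  moreover have "drift P g u \<le> (\<Sum>x\<in>nbrs P u. 1)"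
    unfolding drift_def
  proof (rule sum_mono)
    fix x assume "x \<in> nbrs P u"
    then show "g x - g u \<le> 1"
      using graph_dist_Suc_le[OF P u, of x u] by (simp add: g_def)
  qed
  ultimately show ?case by (simp add: g_def)
next
  case (Suc n)
  have "(u, w) \<in> graph_rel P ^^ Suc n" using graph_dist_path[OF P u Suc.prems] Suc.hyps(2) by simp
  then obtain v where v: "(u, v) \<in> graph_rel P ^^ n" "w \<in> nbrs P v"
    by (auto simp: graph_rel_def)
  have "graph_dist P u v = n"
    using graph_dist_le[OF v(1)] graph_dist_Suc_le[OF P u v(2)] Suc.hyps(2) by linarith
  moreover have ev: "v extreme_point_of P" using v nbrs_extreme(2) by blast
  ultimately have IH: "drift P g v \<le> int (card (nbrs P u)) - int n"
    using Suc.hyps(1)[of v] by (simp add: g_def)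
  have "forman_ricci P (closed_segment v w) \<le> drift P g v - drift P g w"
  proof (rule drift_diff_ge_forman_ricci[OF P v(2)])
    show "g w = g v + 1" using \<open>graph_dist P u v = n\<close> Suc.hyps(2) by (simp add: g_def)
    fix x y assume "y \<in> nbrs P x"
    then show "\<bar>g x - g y\<bar> \<le> 1"
      using graph_dist_Suc_le[OF P u, of y x] graph_dist_Suc_le[OF P u, of x y] nbrs_sym[of y P x]
      by (simp add: g_def)
  qed
  moreover have "forman_ricci P (closed_segment v w) > 0"
    using pos v by (simp add: forman_ricci_positive_def nbrs_def)
  moreover have "g w = int n + 1" using Suc.hyps(2) by (simp add: g_def)
  ultimately show ?case using IH by linarith
qed

lemma graph_dist_bound:
  fixes P :: "'a::euclidean_space set"
  assumes P: "polytope P" and pos: "forman_ricci_positive P" and u: "u extreme_point_of P"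
    and w: "w extreme_point_of P"
  shows "graph_dist P u w \<le> card (nbrs P u) + card (nbrs P w)"
proof -
  define g where "g = (\<lambda>x. int (graph_dist P u x))"
  have "(\<Sum>x\<in>nbrs P w. - 1) \<le> drift P g w"
    unfolding drift_def
  proof (rule sum_mono)
    fix x assume "x \<in> nbrs P w"
    then show "- 1 \<le> g x - g w"
      using graph_dist_Suc_le[OF P u, of w x] nbrs_sym[of x P w] by (simp add: g_def)
  qed
  moreover have "drift P g w \<le> int (card (nbrs P u)) - g w"
    using drift_graph_dist_le[OF assms] by (simp add: g_def)
  ultimately show ?thesis by (simp add: g_def)
qed

text \<open>Increasing the radius by one adds at most \<open>D\<close> successors per element, so
  the size grows by a factor of at most \<open>D + 1\<close>.\<close>

lemma card_relpow_ball_le: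
  fixes R :: "('a \<times> 'a) set"
  assumes fin: "\<And>x. finite {y. (x, y) \<in> R}" and deg: "\<And>x. card {y. (x, y) \<in> R} \<le> D"
  shows "finite {y. \<exists>k\<le>n. (u, y) \<in> R ^^ k} \<and> card {y. \<exists>k\<le>n. (u, y) \<in> R ^^ k} \<le> (D + 1) ^ n"
proof (induction n)
  case 0
  have "{y. \<exists>k\<le>0. (u, y) \<in> R ^^ k} = {u}" by auto
  then show ?case by simp
next
  case (Suc n)
  define B where "B = {y. \<exists>k\<le>n. (u, y) \<in> R ^^ k}"
  have B: "finite B" "card B \<le> (D + 1) ^ n" using Suc by (auto simp: B_def)
  have sub: "{y. \<exists>k\<le>Suc n. (u, y) \<in> R ^^ k} \<subseteq> B \<union> (\<Union>x\<in>B. {y. (x, y) \<in> R})"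
  proof
    fix y assume "y \<in> {y. \<exists>k\<le>Suc n. (u, y) \<in> R ^^ k}"
    then obtain k where k: "k \<le> Suc n" "(u, y) \<in> R ^^ k" by blast
    show "y \<in> B \<union> (\<Union>x\<in>B. {y. (x, y) \<in> R})"
    proof (cases k)
      case 0
      then show ?thesis using k by (auto simp: B_def)
    next
      case (Suc m)
      then obtain x where "(u, x) \<in> R ^^ m" "(x, y) \<in> R" using k by auto
      moreover have "m \<le> n" using Suc k by simp
      ultimately show ?thesis unfolding B_def by blast
    qed
  qed
  have fin': "finite (B \<union> (\<Union>x\<in>B. {y. (x, y) \<in> R}))" using B fin by auto
  have "card (B \<union> (\<Union>x\<in>B. {y. (x, y) \<in> R})) \<le> card B + card (\<Union>x\<in>B. {y. (x, y) \<in> R})"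
    by (rule card_Un_le)
  also have "card (\<Union>x\<in>B. {y. (x, y) \<in> R}) \<le> (\<Sum>x\<in>B. card {y. (x, y) \<in> R})"
    using B(1) by (rule card_UN_le)
  also have "\<dots> \<le> card B * D" using sum_bounded_above[of B "\<lambda>x. card {y. (x, y) \<in> R}" D] deg by simp
  finally have "card (B \<union> (\<Union>x\<in>B. {y. (x, y) \<in> R})) \<le> card B * (D + 1)" by simp
  also have "\<dots> \<le> (D + 1) ^ n * (D + 1)" using B(2) by (rule mult_le_mono1)
  also have "\<dots> = (D + 1) ^ Suc n" by simp
  finally show ?case
    using finite_subset[OF sub fin'] card_mono[OF fin' sub] by linarith
qed

lemma card_extreme_points_bound:
  fixes P :: "'a::euclidean_space set"
  assumes P: "polytope P" and pos: "forman_ricci_positive P" and D: "\<And>x. card (nbrs P x) \<le> D"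
  shows "card {v. v extreme_point_of P} \<le> (D + 1) ^ (2 * D)"
proof (cases "{v. v extreme_point_of P} = {}")
  case False
  then obtain u where u: "u extreme_point_of P" by blast
  let ?B = "{y. \<exists>k\<le>2 * D. (u, y) \<in> graph_rel P ^^ k}"
  have "{v. v extreme_point_of P} \<subseteq> ?B"
  proof
    fix w assume "w \<in> {v. v extreme_point_of P}"
    then have w: "w extreme_point_of P" by simp
    have "graph_dist P u w \<le> 2 * D"
      using graph_dist_bound[OF P pos u w] D[of u] D[of w] by linarith
    then show "w \<in> ?B" using graph_dist_path[OF P u w] by blast
  qed
  moreover have "finite ?B \<and> card ?B \<le> (D + 1) ^ (2 * D)"
    by (rule card_relpow_ball_le) (use finite_nbrs[OF P] D in \<open>auto simp: graph_rel_def\<close>)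
  ultimately show ?thesis using card_mono by (meson order_trans)
next
  case True
  then show ?thesis by simp
qed

section \<open>Combinatorial types\<close>

text \<open>Numbering the vertices places the faces of different polytopes in one common type, where
  they can be compared.\<close>

definition vertex_code :: "('a::euclidean_space \<Rightarrow> nat) \<Rightarrow> 'a set \<Rightarrow> nat set" where
  "vertex_code \<phi> F = \<phi> ` {v. v extreme_point_of F}"

text \<open>A face is the convex hull of its vertices, which are exactly the vertices of
  \<open>P\<close> lying in it.\<close>

lemma vertex_code_subset_iff:
  fixes P :: "'a::euclidean_space set"
  assumes P: "polytope P" and \<phi>: "inj_on \<phi> {v. v extreme_point_of P}"
    and F: "F face_of P" "G face_of P"
  shows "vertex_code \<phi> F \<subseteq> vertex_code \<phi> G \<longleftrightarrow> F \<subseteq> G"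
proof -
  have sub: "{v. v extreme_point_of F} \<subseteq> {v. v extreme_point_of P}" 
    "{v. v extreme_point_of G} \<subseteq> {v. v extreme_point_of P}"
    using extreme_point_of_face F by blast+
  have "vertex_code \<phi> F \<subseteq> vertex_code \<phi> G \<longleftrightarrow> {v. v extreme_point_of F} \<subseteq> {v. v extreme_point_of G}"
    unfolding vertex_code_def using inj_on_image_subset_iff[OF \<phi> sub] .
  also have "\<dots> \<longleftrightarrow> F \<subseteq> G"
  proof
    assume "{v. v extreme_point_of F} \<subseteq> {v. v extreme_point_of G}"
    then show "F \<subseteq> G"
      using polytope_eq_hull_extreme_points face_of_polytope_polytope[OF P] F hull_mono by metis
  next
    assume "F \<subseteq> G"
    then show "{v. v extreme_point_of F} \<subseteq> {v. v extreme_point_of G}"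
      using extreme_point_of_face[OF F(1)] extreme_point_of_face[OF F(2)] by blast
  qed
  finally show ?thesis .
qed

text \<open>Both face lattices are isomorphic to the same family of codes ordered by inclusion;
  compose one coding with the inverse of the other.\<close>

lemma comb_equiv_if_same_vertex_codes:
  fixes P :: "'a::euclidean_space set" and Q :: "'b::euclidean_space set"
  assumes P: "polytope P" and \<phi>: "inj_on \<phi> {v. v extreme_point_of P}"
    and Q: "polytope Q" and \<psi>: "inj_on \<psi> {v. v extreme_point_of Q}"
    and eq: "vertex_code \<phi> ` {F. F face_of P} = vertex_code \<psi> ` {G. G face_of Q}"
  shows "comb_equiv P Q"
proof -
  note sP = vertex_code_subset_iff[OF P \<phi>] and sQ = vertex_code_subset_iff[OF Q \<psi>]
  have "inj_on (vertex_code \<phi>) {F. F face_of P}" 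
    by (rule inj_onI) (metis mem_Collect_eq order_refl sP subset_antisym)
  then have bP: "bij_betw (vertex_code \<phi>) {F. F face_of P} (vertex_code \<phi> ` {F. F face_of P})"
    by (simp add: bij_betw_def)
  have "inj_on (vertex_code \<psi>) {G. G face_of Q}" 
    by (rule inj_onI) (metis mem_Collect_eq order_refl sQ subset_antisym)
  then have bQ: "bij_betw (vertex_code \<psi>) {G. G face_of Q} (vertex_code \<phi> ` {F. F face_of P})"
    by (simp add: bij_betw_def eq)
  define f where "f = inv_into {G. G face_of Q} (vertex_code \<psi>) \<circ> vertex_code \<phi>"
  have bf: "bij_betw f {F. F face_of P} {G. G face_of Q}"
    unfolding f_def using bij_betw_trans[OF bP bij_betw_inv_into[OF bQ]] .
  have ff: "vertex_code \<psi> (f F) = vertex_code \<phi> F" "f F face_of Q" if "F face_of P" for F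
  proof -
    have "vertex_code \<phi> F \<in> vertex_code \<psi> ` {G. G face_of Q}" using that eq by blast
    then show "vertex_code \<psi> (f F) = vertex_code \<phi> F" by (simp add: f_def f_inv_into_f)
    show "f F face_of Q" using bf that by (auto simp: bij_betw_def)
  qed
  have "F \<subseteq> F' \<longleftrightarrow> f F \<subseteq> f F'" if "F face_of P" "F' face_of P" for F F'
    using sP[OF that] sQ[of "f F" "f F'"] ff that by simp
  then show ?thesis unfolding comb_equiv_def using bf by blast
qed

text \<open>With vertices numbered below \<open>N\<close>, the codes of a polytope form a family of
  subsets of \<open>{..<N}\<close>. There are finitely many such families, and each determines the
  class.\<close>

lemma finite_quotient_if_vertices_bounded:
  fixes S :: "'a::euclidean_space set set"
  assumes S: "\<And>P. P \<in> S \<Longrightarrow> polytope P" "\<And>P. P \<in> S \<Longrightarrow> card {v. v extreme_point_of P} \<le> N"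
  shows "finite (S // comb_equiv_rel)"
proof -
  have "\<exists>\<phi>. inj_on \<phi> {v. v extreme_point_of P} \<and> \<phi> ` {v. v extreme_point_of P} \<subseteq> {..<N}"
    if P: "P \<in> S" for P
  proof -
    obtain \<phi> where "bij_betw \<phi> {v. v extreme_point_of P} {0..<card {v. v extreme_point_of P}}"
      using ex_bij_betw_finite_nat[OF polytope_finite_extreme_points[OF S(1)[OF P]]] by blast
    then show ?thesis using S(2)[OF P] by (intro exI[of _ \<phi>]) (auto simp: bij_betw_def)
  qed
  then obtain \<Phi> where \<Phi>: "\<And>P. P \<in> S \<Longrightarrow> inj_on (\<Phi> P) {v. v extreme_point_of P}"
    "\<And>P. P \<in> S \<Longrightarrow> \<Phi> P ` {v. v extreme_point_of P} \<subseteq> {..<N}" by metis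
  define c where "c P = vertex_code (\<Phi> P) ` {F. F face_of P}" for P
  have "c ` S \<subseteq> Pow (Pow {..<N})"
  proof -
    have "vertex_code (\<Phi> P) F \<subseteq> {..<N}" if "P \<in> S" "F face_of P" for P F
      using \<Phi>(2)[OF that(1)] extreme_point_of_face[OF that(2)] unfolding vertex_code_def by blast
    then show ?thesis unfolding c_def by blast
  qed
  then have fin: "finite (c ` S)" by (rule finite_subset) simp
  have cls: "comb_equiv_rel `` {P} = comb_equiv_rel `` {Q}" if "P \<in> S" "Q \<in> S" "c P = c Q" for P Q
  proof (rule equiv_class_eq[OF equiv_comb_equiv_rel])
    have "comb_equiv P Q"
      using comb_equiv_if_same_vertex_codes[OF S(1)[OF that(1)] \<Phi>(1)[OF that(1)]
          S(1)[OF that(2)] \<Phi>(1)[OF that(2)]] that(3)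
      by (simp add: c_def)
    then show "(P, Q) \<in> comb_equiv_rel" using S that by (simp add: comb_equiv_rel_def)
  qed
  \<comment> \<open>\<open>inv_into\<close> picks one polytope of \<open>S\<close> for each family
    of codes; its class is that of every polytope with this family.\<close>
  have "S // comb_equiv_rel \<subseteq> (\<lambda>C. comb_equiv_rel `` {inv_into S c C}) ` (c ` S)"
  proof
    fix X assume "X \<in> S // comb_equiv_rel"
    then obtain P where P: "P \<in> S" "X = comb_equiv_rel `` {P}" by (auto simp: quotient_def)
    have "inv_into S c (c P) \<in> S" "c (inv_into S c (c P)) = c P"
      using P(1) by (simp_all add: inv_into_into f_inv_into_f)
    then have "X = comb_equiv_rel `` {inv_into S c (c P)}" using cls P by metis
    then show "X \<in> (\<lambda>C. comb_equiv_rel `` {inv_into S c C}) ` (c ` S)" using P(1) by blast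
  qed
  then show ?thesis using fin finite_surj by blast
qed

theorem theorem1p10:
  shows "finite ({P :: 'a::euclidean_space set.
                    polytope P \<and> aff_dim P = 4 \<and> forman_ricci_positive P} // comb_equiv_rel)"
proof (rule finite_quotient_if_vertices_bounded)
  fix P :: "'a set"
  assume "P \<in> {P. polytope P \<and> aff_dim P = 4 \<and> forman_ricci_positive P}"
  then have P: "polytope P" "aff_dim P \<le> 4" "forman_ricci_positive P" by auto
  show "polytope P" using P by blast
  \<comment> \<open>Degrees are at most 130, so the diameter is at most \<open>2 * 130\<close> and
    balls grow by a factor of at most 131 per step.\<close>
  show "card {v. v extreme_point_of P} \<le> (130 + 1) ^ (2 * 130)"
    using card_extreme_points_bound[OF P(1,3)] card_nbrs_bound[OF P] by blast
qed

end
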